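(* Let $\frac23<\alpha,\beta\le 1$, and let $\mu$ be a probability measure supported on $E\subset[0,1]$ and obeying the following two assumptions: (A) $\mu([x,x+\epsilon])\le C_1\epsilon^{\alpha}$ for all $0<\epsilon\le 1$, (B) $|\widehat{\mu}(k)|\le C_2(1-\alpha)^{-B}|k|^{-\beta/2}$ for all $k\neq 0$. Then there exists an absolute constant $A$ such that $$\left[\int |f|^2\,d\mu\right]^{1/2}\le 2^{6B}A\,C_2^{\theta}\,C_1^{1-\theta}\,\|\widehat{f}\|_{\ell^p(\mathbb{Z})},$$ where $$p=\frac{2(\beta+4(1-\alpha))}{\beta+8(1-\alpha)}\qquad\text{and}\qquad \theta=\frac{2}{p}-1 .$$
   Context: $C_1,C_2,B$ are the constants appearing in assumptions (A) and (B). For a measure $\mu$ on $[0,1]$, $\widehat{\mu}(k)=\int_0^1 e^{-2\pi i kx}\,d\mu(x)$ for $k\in\mathbb{Z}$. Here $f$ denotes a function on $[0,1]$ with Fourier coefficients $\widehat{f}(k)=\int_0^1 f(x)e^{-2\pi i kx}\,dx$, $k\in\mathbb{Z}$. The inequality is a Fourier restriction estimate for $\mu$.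
   Formalization: The constants are normalised by C_2 ≥ 1 and B ≥ 0, and f is taken integrable on [0,1] and continuous at μ-almost every point; the estimate fails without such conditions (f = 1 with Lebesgue measure and C_2 → 0; f the indicator of a Lebesgue-null set carrying μ). *)

theory Defs
  imports "HOL-Probability.Probability"
begin

definition fourier_measure :: "real measure \<Rightarrow> int \<Rightarrow> complex" where
  "fourier_measure \<mu> k =
     (LINT x:{0..1}|\<mu>. exp (- 2 * complex_of_real pi * \<i> * of_int k * of_real x))"

definition fourier_fun :: "(real \<Rightarrow> complex) \<Rightarrow> int \<Rightarrow> complex" where
  "fourier_fun f k =
     (LINT x:{0..1}|lborel. f x * exp (- 2 * complex_of_real pi * \<i> * of_int k * of_real x))"

definition in_lp :: "real \<Rightarrow> (int \<Rightarrow> complex) \<Rightarrow> bool" where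
  "in_lp p c \<longleftrightarrow> (\<lambda>k. norm (c k) powr p) summable_on UNIV"

text \<open>Only meaningful under \<^const>\<open>in_lp\<close>: \<^const>\<open>infsum\<close> of a divergent family is \<open>0\<close>.\<close>
definition lp_norm :: "real \<Rightarrow> (int \<Rightarrow> complex) \<Rightarrow> real" where
  "lp_norm p c = (\<Sum>\<^sub>\<infinity>k. norm (c k) powr p) powr (1 / p)"

text \<open>A Borel probability measure on the line carried by \<open>E\<close>; \<open>E\<close> itself need not be Borel.\<close>
definition prob_measure_on :: "real set \<Rightarrow> real measure \<Rightarrow> bool" where
  "prob_measure_on E \<mu> \<longleftrightarrow> prob_space \<mu> \<and> sets \<mu> = sets borel \<and> (AE x in \<mu>. x \<in> E)"

definition ball_condition :: "real \<Rightarrow> real \<Rightarrow> real measure \<Rightarrow> bool" where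
  "ball_condition C1 \<alpha> \<mu> \<longleftrightarrow>
     (\<forall>x\<in>{0..1}. \<forall>\<epsilon>. 0 < \<epsilon> \<and> \<epsilon> \<le> 1 \<longrightarrow> measure \<mu> {x..x + \<epsilon>} \<le> C1 * \<epsilon> powr \<alpha>)"

text \<open>
  For \<open>\<alpha> = 1\<close> the factor \<open>(1 - \<alpha>)\<close> to the power \<open>-B\<close> is infinite, so nothing is demanded.
  The guard is needed because \<open>0 powr (-B) = 0\<close> in HOL, which would instead
  force all nonzero Fourier coefficients to vanish.
  The constants are normalised by \<open>1 \<le> C2\<close> and \<open>0 \<le> B\<close> where the condition is used: Lebesgue
  measure satisfies it for arbitrarily small \<open>C2\<close> and arbitrarily negative \<open>B\<close>, and then
  \<open>f = 1\<close> violates the estimate for any fixed absolute constant.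
\<close>
definition decay_condition ::
    "real \<Rightarrow> real \<Rightarrow> real \<Rightarrow> real \<Rightarrow> real measure \<Rightarrow> bool" where
  "decay_condition C2 B \<alpha> \<beta> \<mu> \<longleftrightarrow>
     (\<alpha> < 1 \<longrightarrow> (\<forall>k. k \<noteq> 0 \<longrightarrow>
        norm (fourier_measure \<mu> k)
          \<le> C2 * (1 - \<alpha>) powr (- B) * \<bar>real_of_int k\<bar> powr (- \<beta> / 2)))"

text \<open>
  The functions on \<open>[0,1]\<close> for which both sides of the estimate make sense. The measure \<open>\<mu>\<close>
  may be carried by a Lebesgue null set, and changing an integrable \<open>f\<close> there changes the
  left-hand side but no Fourier coefficient; so the values of \<open>f\<close> have to be tied to its
  Lebesgue class at \<open>\<mu>\<close>-almost every point, which continuity there does. Every continuous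
  \<open>f\<close> on \<open>[0,1]\<close> qualifies, without \<open>f 0 = f 1\<close>.
  Integrability over \<^const>\<open>lborel\<close> includes Borel measurability on \<open>[0,1]\<close>.
\<close>
definition admissible :: "real measure \<Rightarrow> (real \<Rightarrow> complex) \<Rightarrow> bool" where
  "admissible \<mu> f \<longleftrightarrow>
     set_integrable lborel {0..1} f \<and> (AE x in \<mu>. continuous (at x within {0..1}) f)"

end

theory Submission
  imports Defs
begin

text \<open>
Write \<open>\<delta> = 1 - \<alpha>\<close>. It is enough to bound \<open>\<integral> |g|\<^sup>2 d\<mu>\<close>, the energy of \<open>g\<close>, by the square of the \<open>\<ell>\<^sup>p\<close> norm
of the coefficients \<open>c\<close> of a trigonometric polynomial \<open>g\<close>. The Fejer means of \<open>f\<close> have coefficients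
no larger than those of \<open>f\<close> and converge to \<open>f\<close> at \<open>\<mu>\<close>-almost every point, because \<open>f\<close> is continuous
there and \<open>\<mu>\<close> has no mass at the endpoints; Fatou's lemma then gives the estimate for \<open>f\<close>
(\<open>restriction_estimate_of_trig_poly_estimate\<close>).

The energy is a quadratic form in \<open>c\<close> whose matrix consists of the Fourier coefficients of \<open>\<mu>\<close>. At a
scale \<open>N\<close> it is split with the Fejer weights. The damped form is an average of energies of pieces of \<open>g\<close>
with \<open>N\<close> consecutive frequencies; a local Sobolev inequality on intervals of length \<open>1 / N\<close> and the
ball condition bound it by \<open>C1 * N powr \<delta>\<close> times the squared \<open>\<ell>\<^sup>2\<close> norm of \<open>c\<close> (\<open>energy_window\<close>). The
remainder has matrix entries at most \<open>D * N powr (- \<beta> / 2)\<close>, where \<open>D = C2 * \<delta> powr (- B)\<close>, and is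
bounded by this times the squared \<open>\<ell>\<^sup>1\<close> norm (\<open>energy_le_scale_nat\<close>). Optimising the scale yields the
geometric mean of the two bounds with weights \<open>1 - t\<close> and \<open>t = \<delta> / (\<delta> + \<beta> / 2)\<close> (\<open>energy_restricted\<close>).

The exponent \<open>p\<close> lies below the one natural for that geometric mean, by an amount of order \<open>\<delta>\<close>. This
gap makes the bounds for the level sets of \<open>|c|\<close> summable. To keep the sum independent of \<open>\<delta>\<close>, the
levels are taken in the ratio \<open>2 powr (1 / s)\<close> with \<open>s\<close> of order \<open>\<delta>\<close> instead of the ratio \<open>2\<close>: the
contributions then decay like \<open>(1/4) ^ l\<close>, whatever \<open>\<delta>\<close> is (\<open>energy_strong_type\<close>). What remains of the
factor \<open>\<delta> powr (- B)\<close> is \<open>\<delta> powr (- B * t)\<close> with \<open>t \<le> 3 * \<delta>\<close>, hence at most \<open>2 powr (12 * B)\<close>, and its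
square root is the factor \<open>2 powr (6 * B)\<close> of the theorem (\<open>energy_le_lp\<close>). For \<open>\<delta> = 0\<close> the exponent is
\<open>p = 2\<close>, and the window bound alone is the estimate.
\<close>

section \<open>Characters and trigonometric polynomials\<close>

definition character :: "int \<Rightarrow> real \<Rightarrow> complex" where
  "character k x = cis (2 * pi * of_int k * x)"

definition trig_poly :: "int set \<Rightarrow> (int \<Rightarrow> complex) \<Rightarrow> real \<Rightarrow> complex" where
  "trig_poly S c x = (\<Sum>k\<in>S. c k * character k x)"

lemma norm_character [simp]: "norm (character k x) = 1"
  by (simp add: character_def)

lemma character_mult_cnj: "character k x * cnj (character l x) = character (k - l) x"
  by (simp add: character_def cis_cnj cis_mult algebra_simps)

lemma character_0 [simp]: "character 0 x = 1"
  by (simp add: character_def)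

lemma character_add: "character (k + l) x = character k x * character l x"
  by (simp add: character_def cis_mult algebra_simps)

lemma character_diff_arg: "character k (x - y) = character k x * cnj (character k y)"
  by (simp add: character_def cis_cnj cis_mult algebra_simps)

lemma character_conv_exp:
  "character (- k) x = exp (- 2 * complex_of_real pi * \<i> * of_int k * of_real x)"
  by (simp add: character_def cis_conv_exp mult_ac)

lemma character_has_vector_derivative:
  "(character k has_vector_derivative (2 * pi * of_int k) *\<^sub>R (\<i> * character k x)) (at x within S)"
proof -
  have "((\<lambda>x. cis (2 * pi * of_int k * x)) has_derivative
      (\<lambda>h. (2 * pi * of_int k * h) *\<^sub>R (\<i> * cis (2 * pi * of_int k * x)))) (at x within S)"
    by (rule has_derivative_eq_rhs, rule has_derivative_cis)
       (auto intro!: derivative_eq_intros simp: fun_eq_iff)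
  then show ?thesis
    by (simp add: character_def[abs_def] has_vector_derivative_def mult_ac)
qed

lemma continuous_on_character [continuous_intros]: "continuous_on S (character k)"
  unfolding character_def[abs_def] by (intro continuous_intros)

lemma character_borel [measurable]: "character k \<in> borel_measurable borel"
  by (intro borel_measurable_continuous_onI continuous_on_character)

lemma character_has_integral:
  "(character k has_integral (if k = 0 then 1 else 0)) {0..1}"
proof (cases "k = 0")
  case True
  have "character k = (\<lambda>x. 1)" using True by auto
  with True show ?thesis using has_integral_const_real[of "1::complex" 0 1] by simp
next
  case False
  let ?F = "\<lambda>x. character k x / (2 * pi * of_int k * \<i>)"
  have "(?F has_vector_derivative character k x) (at x within {0..1})" for x
    using False
    by (auto intro!: derivative_eq_intros character_has_vector_derivative
        simp: scaleR_conv_of_real divide_simps)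
  then have "(character k has_integral (?F 1 - ?F 0)) {0..1}"
    by (intro fundamental_theorem_of_calculus) auto
  moreover have "?F 1 - ?F 0 = 0"
    using cis_multiple_2pi[of "of_int k"] by (simp add: character_def mult_ac)
  ultimately show ?thesis using False by simp
qed

lemma trig_poly_norm_sq:
  "complex_of_real ((norm (trig_poly S c x))\<^sup>2) =
     (\<Sum>k\<in>S. \<Sum>l\<in>S. c k * cnj (c l) * character (k - l) x)"
proof -
  have "complex_of_real ((norm (trig_poly S c x))\<^sup>2) = trig_poly S c x * cnj (trig_poly S c x)"
    by (rule complex_norm_square)
  also have "\<dots> = (\<Sum>k\<in>S. \<Sum>l\<in>S. c k * cnj (c l) * (character k x * cnj (character l x)))"
    by (simp add: trig_poly_def sum_product mult_ac)
  finally show ?thesis by (simp only: character_mult_cnj)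
qed

lemma norm_trig_poly_le: "norm (trig_poly S c x) \<le> (\<Sum>k\<in>S. norm (c k))"
  unfolding trig_poly_def
  by (rule order_trans[OF norm_sum]) (simp add: norm_mult)

lemma continuous_on_trig_poly [continuous_intros]: "continuous_on T (trig_poly S c)"
  unfolding trig_poly_def by (intro continuous_intros)

lemma trig_poly_borel [measurable]: "trig_poly S c \<in> borel_measurable borel"
  by (intro borel_measurable_continuous_onI continuous_on_trig_poly)

lemma trig_poly_has_vector_derivative:
  "(trig_poly S c has_vector_derivative trig_poly S (\<lambda>k. c k * (2 * pi * of_int k * \<i>)) x)
     (at x within T)"
  unfolding trig_poly_def
  by (auto intro!: derivative_eq_intros character_has_vector_derivative sum.cong
      simp: scaleR_conv_of_real mult_ac)

lemma parseval_trig_poly: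
  assumes "finite S"
  shows "((\<lambda>x. (norm (trig_poly S c x))\<^sup>2) has_integral (\<Sum>k\<in>S. (norm (c k))\<^sup>2)) {0..1}"
proof -
  have "((\<lambda>x. \<Sum>k\<in>S. \<Sum>l\<in>S. c k * cnj (c l) * character (k - l) x)
      has_integral (\<Sum>k\<in>S. \<Sum>l\<in>S. c k * cnj (c l) * (if k - l = 0 then 1 else 0))) {0..1}"
    using assms by (intro has_integral_sum has_integral_mult_right character_has_integral) auto
  also have "(\<Sum>k\<in>S. \<Sum>l\<in>S. c k * cnj (c l) * (if k - l = 0 then 1 else 0))
      = complex_of_real (\<Sum>k\<in>S. (norm (c k))\<^sup>2)"
    using assms by (simp add: complex_norm_square if_distrib[of "\<lambda>z. _ * z"] del: of_real_power cong: if_cong)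
  finally have "((\<lambda>x. complex_of_real ((norm (trig_poly S c x))\<^sup>2))
      has_integral complex_of_real (\<Sum>k\<in>S. (norm (c k))\<^sup>2)) {0..1}"
    by (simp only: trig_poly_norm_sq)
  from has_integral_linear[OF this bounded_linear_Re] show ?thesis
    by (simp add: o_def del: of_real_sum of_real_power)
qed

section \<open>Frequencies in a window: the ball condition\<close>

text \<open>
The values of \<open>|h|\<^sup>2\<close> at two points of an interval differ by at most the integral of its
derivative \<open>2 (h \<bullet> h')\<close>, and \<open>2 |h| |h'| \<le> (|h|\<^sup>2 + L\<^sup>2 |h'|\<^sup>2) / L\<close>. Averaging over the interval
then turns a point value into an integral. The weight \<open>L\<^sup>2\<close> on \<open>|h'|\<^sup>2\<close> is the one for which both
terms are comparable when \<open>h\<close> has frequencies up to \<open>1 / L\<close>.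
\<close>

lemma sobolev_interval:
  fixes h h' :: "real \<Rightarrow> complex"
  assumes L: "L > 0" and x: "x \<in> {a..a+L}"
    and deriv: "\<And>y. (h has_vector_derivative h' y) (at y within {a..a+L})"
    and cont': "continuous_on {a..a+L} h'"
  shows "(norm (h x))\<^sup>2 \<le> 2 / L * integral {a..a+L} (\<lambda>y. (norm (h y))\<^sup>2 + L\<^sup>2 * (norm (h' y))\<^sup>2)"
proof -
  let ?I = "{a..a+L}"
  define H where "H = (\<lambda>y. (norm (h y))\<^sup>2 + L\<^sup>2 * (norm (h' y))\<^sup>2)"
  have cont: "continuous_on ?I h"
    using has_vector_derivative_continuous[OF deriv]
    by (simp add: continuous_on_eq_continuous_within)
  have contH: "continuous_on ?I H"
    unfolding H_def by (intro continuous_intros cont cont')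
  have intH: "H integrable_on ?I" by (rule integrable_continuous_real[OF contH])
  have H0: "H y \<ge> 0" for y by (simp add: H_def)
  have dG: "((\<lambda>y. (norm (h y))\<^sup>2) has_vector_derivative 2 * (h y \<bullet> h' y)) (at y within ?I)" for y
    unfolding power2_norm_eq_inner using deriv[of y]
    by (auto intro!: derivative_eq_intros simp: has_vector_derivative_def inner_commute fun_eq_iff)
  have dGH: "\<bar>2 * (h y \<bullet> h' y)\<bar> \<le> H y / L" for y
  proof -
    have "2 * (norm (h y) * (L * norm (h' y))) \<le> H y"
      unfolding H_def using sum_squares_bound[of "norm (h y)" "L * norm (h' y)"]
      by (simp add: power_mult_distrib mult_ac)
    moreover have "L * \<bar>h y \<bullet> h' y\<bar> \<le> L * (norm (h y) * norm (h' y))"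
      using L Cauchy_Schwarz_ineq2 by (intro mult_left_mono) auto
    ultimately have "L * \<bar>h y \<bullet> h' y\<bar> * 2 \<le> H y"
      by (simp add: mult_ac)
    then show ?thesis using L by (simp add: pos_le_divide_eq abs_mult mult_ac)
  qed
  have step: "\<bar>(norm (h v))\<^sup>2 - (norm (h u))\<^sup>2\<bar> \<le> integral ?I H / L"
    if uv: "u \<in> ?I" "v \<in> ?I" "u \<le> v" for u v
  proof -
    have sub: "{u..v} \<subseteq> ?I" using uv by auto
    have "((\<lambda>y. 2 * (h y \<bullet> h' y)) has_integral ((norm (h v))\<^sup>2 - (norm (h u))\<^sup>2)) {u..v}"
      using uv sub
      by (intro fundamental_theorem_of_calculus)
         (auto intro: has_vector_derivative_within_subset[OF dG])
    moreover have "(\<lambda>y. H y / L) integrable_on {u..v}"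
      using intH sub integrable_subinterval_real integrable_on_divide by blast
    ultimately have "\<bar>(norm (h v))\<^sup>2 - (norm (h u))\<^sup>2\<bar> \<le> integral {u..v} (\<lambda>y. H y / L)"
      using integral_norm_bound_integral[of "\<lambda>y. 2 * (h y \<bullet> h' y)" "{u..v}" "\<lambda>y. H y / L"] dGH
      by (auto simp: has_integral_iff)
    also have "\<dots> \<le> integral ?I (\<lambda>y. H y / L)"
      using sub intH H0 L integrable_subinterval_real[OF intH sub]
      by (intro integral_subset_le integrable_on_divide) auto
    finally show ?thesis by simp
  qed
  have "integral ?I (\<lambda>y. (norm (h x))\<^sup>2) \<le> integral ?I (\<lambda>y. H y + integral ?I H / L)"
  proof (rule integral_le)
    show "(\<lambda>y. H y + integral ?I H / L) integrable_on ?I"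
      by (intro integrable_continuous_real continuous_intros contH)
    fix y assume y: "y \<in> ?I"
    have "\<bar>(norm (h x))\<^sup>2 - (norm (h y))\<^sup>2\<bar> \<le> integral ?I H / L"
      using step[OF x y] step[OF y x] by (cases "x \<le> y") (auto simp: abs_minus_commute)
    moreover have "(norm (h y))\<^sup>2 \<le> H y" by (simp add: H_def)
    ultimately show "(norm (h x))\<^sup>2 \<le> H y + integral ?I H / L" by linarith
  qed auto
  also have "\<dots> = integral ?I H + integral ?I H"
    using L intH by (subst integral_add) auto
  finally show ?thesis using L unfolding H_def
    by (simp add: field_simps)
qed

locale unit_interval_measure = prob_space \<mu> for \<mu> :: "real measure" +
  assumes sets_eq_borel [measurable_cong, simp]: "sets \<mu> = sets borel"
    and AE_unit_interval: "AE x in \<mu>. x \<in> {0..1}"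
begin

lemma integrable_bounded_borel:
  fixes g :: "real \<Rightarrow> 'b :: {banach, second_countable_topology}"
  assumes "g \<in> borel_measurable borel" "\<And>x. norm (g x) \<le> b"
  shows "integrable \<mu> g"
  using assms measurable_cong_sets[OF sets_eq_borel refl]
  by (intro integrable_const_bound[where B = b]) auto

lemma integrable_character: "integrable \<mu> (character k)"
  by (rule integrable_bounded_borel[where b = 1]) auto

lemma integrable_trig_poly_sq: "integrable \<mu> (\<lambda>x. (norm (trig_poly S c x))\<^sup>2)"
  by (rule integrable_bounded_borel[where b = "(\<Sum>k\<in>S. norm (c k))\<^sup>2"])
     (simp_all add: power_mono norm_trig_poly_le)

text \<open>
For finite \<open>S\<close> this is a positive semidefinite quadratic form in the coefficients, with matrix given
by the Fourier coefficients of the measure; the whole argument consists of bounds for it.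
\<close>

definition energy :: "int set \<Rightarrow> (int \<Rightarrow> complex) \<Rightarrow> real" where
  "energy S c = (LINT x|\<mu>. (norm (trig_poly S c x))\<^sup>2)"

lemma energy_nonneg: "energy S c \<ge> 0"
  unfolding energy_def by simp

lemma energy_eq_sum:
  "complex_of_real (energy S c) =
     (\<Sum>k\<in>S. \<Sum>l\<in>S. c k * cnj (c l) * (LINT x|\<mu>. character (k - l) x))"
  unfolding energy_def integral_complex_of_real[symmetric] trig_poly_norm_sq
  by (simp add: integrable_character)

lemma energy_le_sum_norm_sq: "energy S c \<le> (\<Sum>k\<in>S. norm (c k))\<^sup>2"
proof -
  have "energy S c \<le> (LINT x|\<mu>. (\<Sum>k\<in>S. norm (c k))\<^sup>2)"
    unfolding energy_def
    by (intro integral_mono integrable_trig_poly_sq) (simp_all add: power_mono norm_trig_poly_le)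
  then show ?thesis by (simp add: prob_space)
qed

end

lemma integral_sum_intervals:
  fixes H :: "real \<Rightarrow> real"
  assumes "continuous_on UNIV H" "L > 0"
  shows "(\<Sum>j<n. integral {of_nat j * L..of_nat j * L + L} H) = integral {0..of_nat n * L} H"
proof (induction n)
  case (Suc n)
  have "integral {0..of_nat n * L} H + integral {of_nat n * L..of_nat n * L + L} H
      = integral {0..of_nat n * L + L} H"
    using assms
    by (intro Henstock_Kurzweil_Integration.integral_combine integrable_continuous_real)
       (auto intro: continuous_on_subset)
  with Suc show ?case by (simp add: algebra_simps)
qed simp

context unit_interval_measure
begin

text \<open>
A large sieve inequality for \<open>\<mu>\<close>, in the manner of Gallagher. Multiplying by a character changes no
modulus, so the frequencies may be taken in \<open>{0..<N}\<close>; on each of the \<open>N\<close> intervals of length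
\<open>1 / N\<close> the supremum of \<open>|h|\<^sup>2\<close> is controlled by a local Sobolev integral, and the interval carries
mass at most \<open>C1 * N powr (-\<alpha>)\<close>. The local integrals add up to one over \<open>{0..1}\<close>, which Parseval evaluates.
\<close>

lemma energy_window:
  assumes ball: "ball_condition C1 \<alpha> \<mu>"
    and S: "S \<subseteq> {n..<n + int N}" and N: "N \<ge> 1"
  shows "energy S c \<le> 2 * (1 + 4 * pi\<^sup>2) * C1 * real N powr (1 - \<alpha>) * (\<Sum>k\<in>S. (norm (c k))\<^sup>2)"
proof -
  define h where "h = trig_poly ((\<lambda>k. k - n) ` S) (\<lambda>k. c (k + n))"
  define h' where "h' = trig_poly ((\<lambda>k. k - n) ` S) (\<lambda>k. c (k + n) * (2 * pi * of_int k * \<i>))"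
  have fin: "finite S" using S finite_subset by blast
  have h_eq: "trig_poly S c x = character n x * h x" for x
  proof -
    have "h x = (\<Sum>k\<in>S. c k * character (k - n) x)"
      unfolding h_def trig_poly_def by (subst sum.reindex) (auto simp: inj_on_def)
    moreover have "character n x * character (k - n) x = character k x" for k
      using character_add[of n "k - n" x] by simp
    ultimately show ?thesis
      by (simp add: trig_poly_def sum_distrib_left mult.left_commute)
  qed
  define L where "L = 1 / real N"
  have L: "L > 0" "L \<le> 1" using N by (auto simp: L_def)
  define H where "H = (\<lambda>y. (norm (h y))\<^sup>2 + L\<^sup>2 * (norm (h' y))\<^sup>2)"
  define I where "I = (\<lambda>j. {of_nat j * L..of_nat j * L + L})"
  have contH: "continuous_on T H" for T
    unfolding H_def h_def h'_def by (intro continuous_intros)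
  have intH_nonneg: "integral (I j) H \<ge> 0" for j
    by (rule integral_nonneg) (auto simp: I_def H_def intro!: integrable_continuous_real contH[unfolded H_def])
  have point: "(norm (h x))\<^sup>2 \<le> 2 / L * integral (I j) H" if "x \<in> I j" for x j
    unfolding H_def I_def using that[unfolded I_def] L(1)
    by (intro sobolev_interval)
       (simp_all only: h_def h'_def trig_poly_has_vector_derivative continuous_on_trig_poly)
  have cover: "\<exists>j<N. x \<in> I j" if "x \<in> {0..1}" for x
  proof (cases "x = 1")
    case True
    then show ?thesis using N
      by (intro exI[of _ "N - 1"]) (auto simp: I_def L_def field_simps of_nat_diff)
  next
    case False
    define j where "j = nat \<lfloor>x * real N\<rfloor>"
    have "0 \<le> x * N" using that by simp
    then have "real j = of_int \<lfloor>x * real N\<rfloor>" by (simp add: j_def)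
    then have "real j \<le> x * N" "x * N < real j + 1" by linarith+
    moreover have "x * N < N" using that False N by simp
    ultimately have "real j \<le> x * N" "x * N < real j + 1" "real j < N" by linarith+
    then show ?thesis using N
      by (intro exI[of _ j]) (auto simp: I_def L_def field_simps)
  qed
  have total: "(\<Sum>j<N. integral (I j) H) = integral {0..1} H"
    using integral_sum_intervals[OF contH L(1), of N] N by (simp add: I_def) (simp add: L_def)
  have meas: "I j \<in> sets \<mu>" for j by (simp add: I_def)
  have "energy S c = (LINT x|\<mu>. (norm (h x))\<^sup>2)"
    unfolding energy_def h_eq by (simp add: norm_mult)
  also have "\<dots> \<le> (LINT x|\<mu>. (\<Sum>j<N. indicator (I j) x * (2 / L * integral (I j) H)))"
  proof (rule integral_mono_AE)
    show "integrable \<mu> (\<lambda>x. (norm (h x))\<^sup>2)" unfolding h_def by (rule integrable_trig_poly_sq)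
    show "integrable \<mu> (\<lambda>x. \<Sum>j<N. indicator (I j) x * (2 / L * integral (I j) H))"
      using meas by (intro Bochner_Integration.integrable_sum integrable_mult_left integrable_real_indicator)
        (auto simp: emeasure_eq_measure)
    show "AE x in \<mu>. (norm (h x))\<^sup>2 \<le> (\<Sum>j<N. indicator (I j) x * (2 / L * integral (I j) H))"
      using AE_unit_interval
    proof eventually_elim
      case (elim x)
      then obtain j where j: "j < N" "x \<in> I j" using cover by blast
      have "(norm (h x))\<^sup>2 \<le> indicator (I j) x * (2 / L * integral (I j) H)"
        using point j by simp
      also have "\<dots> \<le> (\<Sum>j<N. indicator (I j) x * (2 / L * integral (I j) H))"
        using j L intH_nonneg by (intro member_le_sum) auto
      finally show ?case .
    qed
  qed
  also have "\<dots> = (\<Sum>j<N. measure \<mu> (I j) * (2 / L * integral (I j) H))"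
    using meas by (subst Bochner_Integration.integral_sum) (auto simp: emeasure_eq_measure)
  also have "\<dots> \<le> (\<Sum>j<N. C1 * L powr \<alpha> * (2 / L * integral (I j) H))"
  proof (intro sum_mono mult_right_mono)
    fix j assume "j \<in> {..<N}"
    then have "of_nat j * L \<in> {0..1}" using L by (auto simp: L_def field_simps)
    with ball L show "measure \<mu> (I j) \<le> C1 * L powr \<alpha>"
      unfolding ball_condition_def I_def by blast
  qed (use L intH_nonneg in auto)
  also have "\<dots> = C1 * L powr \<alpha> * (2 / L) * integral {0..1} H"
    unfolding total[symmetric] by (simp add: sum_distrib_left mult.assoc)
  also have "\<dots> \<le> C1 * L powr \<alpha> * (2 / L) * ((1 + 4 * pi\<^sup>2) * (\<Sum>k\<in>S. (norm (c k))\<^sup>2))"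
  proof (rule mult_left_mono)
    have "(H has_integral
        (\<Sum>k\<in>(\<lambda>k. k - n) ` S. (norm (c (k + n)))\<^sup>2) +
        L\<^sup>2 * (\<Sum>k\<in>(\<lambda>k. k - n) ` S. (norm (c (k + n) * (2 * pi * of_int k * \<i>)))\<^sup>2)) {0..1}"
      unfolding H_def h_def h'_def using fin
      by (intro has_integral_add has_integral_mult_right parseval_trig_poly) auto
    then have "integral {0..1} H = (\<Sum>k\<in>S. (norm (c k))\<^sup>2) +
        L\<^sup>2 * (\<Sum>k\<in>S. (norm (c k * (2 * pi * of_int (k - n) * \<i>)))\<^sup>2)"
      by (subst (asm) (1 2) sum.reindex) (auto simp: inj_on_def has_integral_iff)
    also have "\<dots> = (\<Sum>k\<in>S. (norm (c k))\<^sup>2 * (1 + 4 * pi\<^sup>2 * (L * of_int (k - n))\<^sup>2))"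
      unfolding sum_distrib_left sum.distrib[symmetric] norm_mult norm_of_real power_mult_distrib power2_abs
      by (intro sum.cong refl) (simp add: algebra_simps del: of_int_diff)
    also have "\<dots> \<le> (\<Sum>k\<in>S. (norm (c k))\<^sup>2 * (1 + 4 * pi\<^sup>2 * 1))"
    proof (intro sum_mono mult_left_mono add_left_mono)
      fix k assume "k \<in> S"
      then have "0 \<le> k - n" "k - n \<le> int N" using S by auto
      then have "0 \<le> of_int (k - n) * L" "of_int (k - n) * L \<le> 1"
        using N by (simp_all add: L_def field_simps del: of_int_diff)
      then show "(L * of_int (k - n))\<^sup>2 \<le> 1"
        using power_le_one[of "of_int (k - n) * L" 2] by (simp only: mult.commute)
    qed auto
    finally show "integral {0..1} H \<le> (1 + 4 * pi\<^sup>2) * (\<Sum>k\<in>S. (norm (c k))\<^sup>2)"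
      by (simp only: mult_1_right mult_1_left sum_distrib_right[symmetric] mult.commute)
    have "0 \<le> measure \<mu> {0..0 + 1}" by simp
    also have "\<dots> \<le> C1 * 1 powr \<alpha>" using ball[unfolded ball_condition_def, rule_format, of 0 1] by simp
    finally show "0 \<le> C1 * L powr \<alpha> * (2 / L)" using L by simp
  qed
  also have "C1 * L powr \<alpha> * (2 / L) = 2 * C1 * real N powr (1 - \<alpha>)"
    using N by (simp add: L_def powr_diff powr_divide)
  finally show ?thesis
    by (simp add: algebra_simps)
qed

end

section \<open>Fejer weights: the decay condition\<close>

text \<open>
The Fourier coefficients of the Fejer kernel: the triangle function, which is also the fraction of
windows of \<open>N\<close> consecutive integers around one of two frequencies at distance \<open>|j|\<close> that contain the
other. Both roles are used.
\<close>

definition fejer_weight :: "nat \<Rightarrow> int \<Rightarrow> real" where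
  "fejer_weight N j = max 0 (1 - \<bar>of_int j\<bar> / real N)"

lemma card_common_windows:
  assumes "N \<ge> 1" "k \<in> {- M..M}" "l \<in> {- M..M}"
  shows "real (card {n \<in> {- M - int N..M}. k \<in> {n..<n + int N} \<and> l \<in> {n..<n + int N}})
           = real N * fejer_weight N (k - l)"
proof -
  have "{n \<in> {- M - int N..M}. k \<in> {n..<n + int N} \<and> l \<in> {n..<n + int N}}
      = {max k l - int N + 1..min k l}"
    using assms by auto
  then have "card {n \<in> {- M - int N..M}. k \<in> {n..<n + int N} \<and> l \<in> {n..<n + int N}}
      = nat (int N - \<bar>k - l\<bar>)"
    by (auto simp: max_def min_def algebra_simps)
  moreover have "real (nat (int N - \<bar>k - l\<bar>)) = real N * fejer_weight N (k - l)"
    using assms(1) by (auto simp: fejer_weight_def max_def field_simps of_nat_nat)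
  ultimately show ?thesis by simp
qed

text \<open>
The factor \<open>1 - fejer_weight N j = min 1 (|j| / N)\<close> compensates the size of the coefficients at low
frequencies as long as they decay no faster than \<open>1 / |j|\<close>, which is why \<open>b \<le> 1\<close> is needed.
\<close>

lemma one_minus_fejer_weight_le:
  assumes N: "N \<ge> 1" and b: "b \<ge> 0" "b \<le> 1" and j: "j \<noteq> 0"
  shows "\<bar>of_int j\<bar> powr (- b) * (1 - fejer_weight N j) \<le> real N powr (- b)"
proof -
  define y where "y = \<bar>real_of_int j\<bar>"
  have y: "y \<ge> 1" using j by (simp add: y_def)
  show ?thesis
  proof (cases "y \<ge> N")
    case True
    then have "fejer_weight N j = 0" using N by (simp add: fejer_weight_def y_def field_simps)
    moreover have "y powr (- b) \<le> real N powr (- b)"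
      using True N b by (intro powr_mono2') auto
    ultimately show ?thesis by (simp add: y_def)
  next
    case False
    then have "1 - fejer_weight N j = y / N" using N by (simp add: fejer_weight_def y_def field_simps)
    moreover have "y powr (- b) * (y / N) = y powr (1 - b) / N"
      using y by (simp add: powr_diff powr_minus field_simps)
    moreover have "y powr (1 - b) / N \<le> real N powr (1 - b) / N"
      using y False b by (intro divide_right_mono powr_mono2) auto
    moreover have "real N powr (1 - b) / N = real N powr (- b)"
      using N by (simp add: powr_diff powr_minus field_simps)
    ultimately have "y powr (- b) * (1 - fejer_weight N j) \<le> real N powr (- b)"
      by (simp only:)
    then show ?thesis by (simp only: y_def)
  qed
qed

context unit_interval_measure
begin

text \<open>
A pair of frequencies \<open>k\<close>, \<open>l\<close> lies in \<open>N * fejer_weight N (k - l)\<close> common windows, so that damping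
the matrix of the energy form by the Fejer weight amounts to averaging the energies of the pieces
of \<open>c\<close> with frequencies in a window. This does the work of a convolution of \<open>\<mu>\<close> with a Fejer kernel.
\<close>

lemma sum_energy_windows:
  assumes S: "finite S" "S \<subseteq> {- M..M}" and N: "N \<ge> 1"
  shows "complex_of_real (\<Sum>n\<in>{- M - int N..M}. energy (S \<inter> {n..<n + int N}) c)
      = of_nat N * (\<Sum>k\<in>S. \<Sum>l\<in>S. c k * cnj (c l) * (LINT x|\<mu>. character (k - l) x)
                        * of_real (fejer_weight N (k - l)))"
proof -
  let ?W = "{- M - int N..M}" and ?J = "\<lambda>n. {n..<n + int N}"
  define a where "a = (\<lambda>k l. c k * cnj (c l) * (LINT x|\<mu>. character (k - l) x))"
  have "complex_of_real (\<Sum>n\<in>?W. energy (S \<inter> ?J n) c)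
      = (\<Sum>n\<in>?W. \<Sum>k\<in>S \<inter> ?J n. \<Sum>l\<in>S \<inter> ?J n. a k l)"
    by (simp add: energy_eq_sum a_def)
  also have "\<dots> = (\<Sum>n\<in>?W. \<Sum>k\<in>S. \<Sum>l\<in>S. if k \<in> ?J n \<and> l \<in> ?J n then a k l else 0)"
  proof (rule sum.cong[OF refl])
    fix n
    have "(\<Sum>k\<in>S \<inter> ?J n. \<Sum>l\<in>S \<inter> ?J n. a k l)
        = (\<Sum>k\<in>S. if k \<in> ?J n then \<Sum>l\<in>S. if l \<in> ?J n then a k l else 0 else 0)"
      by (simp only: sum.inter_restrict[OF S(1)])
    also have "\<dots> = (\<Sum>k\<in>S. \<Sum>l\<in>S. if k \<in> ?J n \<and> l \<in> ?J n then a k l else 0)"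
    proof (rule sum.cong[OF refl])
      fix k
      show "(if k \<in> ?J n then \<Sum>l\<in>S. if l \<in> ?J n then a k l else 0 else 0)
          = (\<Sum>l\<in>S. if k \<in> ?J n \<and> l \<in> ?J n then a k l else 0)"
        by (cases "k \<in> ?J n") (simp_all only: if_True if_False simp_thms sum.neutral_const)
    qed
    finally show "(\<Sum>k\<in>S \<inter> ?J n. \<Sum>l\<in>S \<inter> ?J n. a k l)
        = (\<Sum>k\<in>S. \<Sum>l\<in>S. if k \<in> ?J n \<and> l \<in> ?J n then a k l else 0)" .
  qed
  also have "\<dots> = (\<Sum>k\<in>S. \<Sum>n\<in>?W. \<Sum>l\<in>S. if k \<in> ?J n \<and> l \<in> ?J n then a k l else 0)"
    by (rule sum.swap)
  also have "\<dots> = (\<Sum>k\<in>S. \<Sum>l\<in>S. \<Sum>n\<in>?W. if k \<in> ?J n \<and> l \<in> ?J n then a k l else 0)"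
    by (intro sum.cong refl sum.swap)
  also have "\<dots> = (\<Sum>k\<in>S. \<Sum>l\<in>S. of_nat N * (a k l * of_real (fejer_weight N (k - l))))"
  proof (intro sum.cong refl)
    fix k l assume "k \<in> S" "l \<in> S"
    then have "real (card {n \<in> ?W. k \<in> ?J n \<and> l \<in> ?J n}) = real N * fejer_weight N (k - l)"
      using S N by (intro card_common_windows) auto
    then have "complex_of_real (real (card {n \<in> ?W. k \<in> ?J n \<and> l \<in> ?J n}))
        = of_real (real N * fejer_weight N (k - l))"
      by (simp only:)
    then have card: "of_nat (card {n \<in> ?W. k \<in> ?J n \<and> l \<in> ?J n})
        = of_nat N * complex_of_real (fejer_weight N (k - l))"
      by (simp only: of_real_mult of_real_of_nat_eq)
    have "(\<Sum>n\<in>?W. if k \<in> ?J n \<and> l \<in> ?J n then a k l else 0)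
        = (\<Sum>n\<in>{n \<in> ?W. k \<in> ?J n \<and> l \<in> ?J n}. a k l)"
      by (rule sum.inter_filter[symmetric]) simp
    also have "\<dots> = of_nat (card {n \<in> ?W. k \<in> ?J n \<and> l \<in> ?J n}) * a k l"
      by (rule sum_constant)
    finally show "(\<Sum>n\<in>?W. if k \<in> ?J n \<and> l \<in> ?J n then a k l else 0)
        = of_nat N * (a k l * of_real (fejer_weight N (k - l)))"
      unfolding card by (simp only: mult_ac)
  qed
  finally show ?thesis by (simp add: a_def sum_distrib_left)
qed

lemma sum_windows:
  fixes a :: "int \<Rightarrow> real"
  assumes S: "finite S" "S \<subseteq> {- M..M}" and N: "N \<ge> 1"
  shows "(\<Sum>n\<in>{- M - int N..M}. \<Sum>k\<in>S \<inter> {n..<n + int N}. a k) = real N * (\<Sum>k\<in>S. a k)"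
proof -
  let ?W = "{- M - int N..M}" and ?J = "\<lambda>n. {n..<n + int N}"
  have "(\<Sum>n\<in>?W. \<Sum>k\<in>S \<inter> ?J n. a k) = (\<Sum>n\<in>?W. \<Sum>k\<in>S. if k \<in> ?J n then a k else 0)"
    using S(1) by (intro sum.cong refl sum.inter_restrict)
  also have "\<dots> = (\<Sum>k\<in>S. \<Sum>n\<in>?W. if k \<in> ?J n then a k else 0)"
    by (rule sum.swap)
  also have "\<dots> = (\<Sum>k\<in>S. real N * a k)"
  proof (intro sum.cong refl)
    fix k assume "k \<in> S"
    then have "real (card {n \<in> ?W. k \<in> ?J n \<and> k \<in> ?J n}) = real N * fejer_weight N (k - k)"
      using S N by (intro card_common_windows) auto
    then have card: "real (card {n \<in> ?W. k \<in> ?J n}) = real N"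
      by (simp add: fejer_weight_def)
    have "(\<Sum>n\<in>?W. if k \<in> ?J n then a k else 0) = (\<Sum>n\<in>{n \<in> ?W. k \<in> ?J n}. a k)"
      by (rule sum.inter_filter[symmetric]) simp
    also have "\<dots> = real (card {n \<in> ?W. k \<in> ?J n}) * a k"
      by (rule sum_constant)
    finally show "(\<Sum>n\<in>?W. if k \<in> ?J n then a k else 0) = real N * a k"
      unfolding card .
  qed
  finally show ?thesis by (simp add: sum_distrib_left)
qed

text \<open>
At scale \<open>1\<close> the ball condition bounds the total mass. The resulting normalisation is what permits
raising the exponent of \<open>C1\<close> in the final constant.
\<close>

lemma ball_condition_C1_ge_1:
  assumes "ball_condition C1 \<alpha> \<mu>"
  shows "C1 \<ge> 1"
proof -
  have "measure \<mu> {0..0 + 1} \<le> C1 * 1 powr \<alpha>"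
    using assms[unfolded ball_condition_def, rule_format, of 0 1] by simp
  moreover have "measure \<mu> {0..1} = 1"
    using AE_unit_interval by (subst prob_eq_1) auto
  ultimately show ?thesis by simp
qed

text \<open>
The energy form splits into its Fejer-damped part, an average of window energies to which the ball
condition applies, and a remainder whose matrix entries are uniformly small by the decay condition.
No sum over dyadic scales is taken on either side, so nothing degenerates as \<open>\<alpha>\<close> tends to \<open>1\<close>.
\<close>

lemma energy_le_scale_nat:
  assumes ball: "ball_condition C1 \<alpha> \<mu>"
    and decay: "\<And>j. j \<noteq> 0 \<Longrightarrow> norm (LINT x|\<mu>. character j x) \<le> D * \<bar>of_int j\<bar> powr (- b)"
    and b: "b \<ge> 0" "b \<le> 1" and D: "D \<ge> 0"
    and S: "finite S" and N: "N \<ge> 1"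
  shows "energy S c \<le> 2 * (1 + 4 * pi\<^sup>2) * C1 * real N powr (1 - \<alpha>) * (\<Sum>k\<in>S. (norm (c k))\<^sup>2)
                     + D * real N powr (- b) * (\<Sum>k\<in>S. norm (c k))\<^sup>2"
proof -
  (* a crude bound for the frequencies; only the existence of one matters *)
  define M where "M = (\<Sum>k\<in>S. \<bar>k\<bar>)"
  have "\<bar>k\<bar> \<le> M" if "k \<in> S" for k
    unfolding M_def using S that by (intro member_le_sum) auto
  then have SM: "S \<subseteq> {- M..M}" by (auto simp: abs_le_iff) (metis minus_le_iff)
  define m where "m = (\<lambda>j. LINT x|\<mu>. character j x)"
  define w where "w = fejer_weight N"
  let ?W = "{- M - int N..M}" and ?J = "\<lambda>n. {n..<n + int N}"
  define V where "V = (\<Sum>n\<in>?W. energy (S \<inter> ?J n) c)"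
  have Npos: "real N > 0" using N by simp
  have V: "V \<le> real N * (2 * (1 + 4 * pi\<^sup>2) * C1 * real N powr (1 - \<alpha>) * (\<Sum>k\<in>S. (norm (c k))\<^sup>2))"
  proof -
    have "V \<le> (\<Sum>n\<in>?W. 2 * (1 + 4 * pi\<^sup>2) * C1 * real N powr (1 - \<alpha>) * (\<Sum>k\<in>S \<inter> ?J n. (norm (c k))\<^sup>2))"
      unfolding V_def using ball N by (intro sum_mono energy_window) auto
    also have "\<dots> = 2 * (1 + 4 * pi\<^sup>2) * C1 * real N powr (1 - \<alpha>) * (real N * (\<Sum>k\<in>S. (norm (c k))\<^sup>2))"
      by (simp only: sum_distrib_left[symmetric] sum_windows[OF S SM N])
    finally show ?thesis by (simp only: mult_ac)
  qed
  have tail: "norm (m j) * (1 - w j) \<le> D * real N powr (- b)" for j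
  proof (cases "j = 0")
    case True
    then show ?thesis using D by (simp add: w_def fejer_weight_def)
  next
    case False
    have "1 - w j \<ge> 0" by (simp add: w_def fejer_weight_def)
    then have "norm (m j) * (1 - w j) \<le> D * \<bar>of_int j\<bar> powr (- b) * (1 - w j)"
      unfolding m_def by (intro mult_right_mono decay False)
    also have "\<dots> = D * (\<bar>of_int j\<bar> powr (- b) * (1 - w j))" by simp
    also have "\<dots> \<le> D * real N powr (- b)"
      unfolding w_def using N b False D by (intro mult_left_mono one_minus_fejer_weight_le)
    finally show ?thesis .
  qed
  have w1: "1 - w j \<ge> 0" for j by (simp add: w_def fejer_weight_def)
  have "complex_of_real V = of_nat N * (\<Sum>k\<in>S. \<Sum>l\<in>S. c k * cnj (c l) * m (k - l) * of_real (w (k - l)))"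
    unfolding V_def m_def w_def by (rule sum_energy_windows[OF S SM N])
  then have "complex_of_real (V / N) = (\<Sum>k\<in>S. \<Sum>l\<in>S. c k * cnj (c l) * m (k - l) * of_real (w (k - l)))"
    using Npos by (simp add: field_simps)
  then have "complex_of_real (energy S c - V / N)
      = (\<Sum>k\<in>S. \<Sum>l\<in>S. c k * cnj (c l) * (m (k - l) * of_real (1 - w (k - l))))"
    unfolding of_real_diff energy_eq_sum m_def
    by (simp add: sum_subtractf[symmetric] algebra_simps)
  then have "energy S c - V / N \<le> norm (\<Sum>k\<in>S. \<Sum>l\<in>S. c k * cnj (c l) * (m (k - l) * of_real (1 - w (k - l))))"
    by (metis abs_ge_self norm_of_real)
  also have "\<dots> \<le> (\<Sum>k\<in>S. \<Sum>l\<in>S. norm (c k) * norm (c l) * (D * real N powr (- b)))"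
  proof (intro sum_norm_le)
    fix k l
    have "norm (c k * cnj (c l) * (m (k - l) * of_real (1 - w (k - l))))
        = norm (c k) * norm (c l) * (norm (m (k - l)) * (1 - w (k - l)))"
      using w1 by (simp only: norm_mult norm_of_real complex_mod_cnj abs_of_nonneg)
    also have "\<dots> \<le> norm (c k) * norm (c l) * (D * real N powr (- b))"
      by (intro mult_left_mono tail) auto
    finally show "norm (c k * cnj (c l) * (m (k - l) * of_real (1 - w (k - l)))) \<le> \<dots>" .
  qed
  also have "\<dots> = D * real N powr (- b) * (\<Sum>k\<in>S. norm (c k))\<^sup>2"
    by (simp add: power2_eq_square sum_product sum_distrib_left mult_ac)
  finally have "energy S c \<le> V / N + D * real N powr (- b) * (\<Sum>k\<in>S. norm (c k))\<^sup>2" by simp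
  moreover have "V / N \<le> 2 * (1 + 4 * pi\<^sup>2) * C1 * real N powr (1 - \<alpha>) * (\<Sum>k\<in>S. (norm (c k))\<^sup>2)"
    using V Npos by (simp add: divide_le_eq mult_ac)
  ultimately show ?thesis by simp
qed

text \<open>
Real scales are needed to optimise later. Rounding up costs a factor at most \<open>2 powr (1 - \<alpha>) \<le> 2\<close>;
for \<open>R < 1\<close>, where no window exists, the second term alone dominates the trivial bound
\<open>(\<Sum>|c k|)\<^sup>2\<close>.
\<close>

lemma energy_le_scale:
  assumes ball: "ball_condition C1 \<alpha> \<mu>"
    and decay: "\<And>j. j \<noteq> 0 \<Longrightarrow> norm (LINT x|\<mu>. character j x) \<le> D * \<bar>of_int j\<bar> powr (- b)"
    and b: "b \<ge> 0" "b \<le> 1" and D: "D \<ge> 1" and \<alpha>: "0 \<le> \<alpha>" "\<alpha> \<le> 1"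
    and S: "finite S" and R: "R > 0"
  shows "energy S c \<le> 4 * (1 + 4 * pi\<^sup>2) * (R powr (1 - \<alpha>) * (C1 * (\<Sum>k\<in>S. (norm (c k))\<^sup>2)))
                     + R powr (- b) * (D * (\<Sum>k\<in>S. norm (c k))\<^sup>2)"
proof (cases "R < 1")
  case True
  have "1 \<le> R powr (- b)" using True R b by (simp add: powr_minus one_le_inverse_iff powr_le1)
  then have "1 * (1 * (\<Sum>k\<in>S. norm (c k))\<^sup>2) \<le> R powr (- b) * (D * (\<Sum>k\<in>S. norm (c k))\<^sup>2)"
    using D by (intro mult_mono) auto
  moreover have "0 \<le> 4 * (1 + 4 * pi\<^sup>2) * (R powr (1 - \<alpha>) * (C1 * (\<Sum>k\<in>S. (norm (c k))\<^sup>2)))"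
    using ball_condition_C1_ge_1[OF ball] by (auto intro!: mult_nonneg_nonneg sum_nonneg)
  ultimately show ?thesis using energy_le_sum_norm_sq[of S c] by linarith
next
  case False
  define N where "N = nat \<lceil>R\<rceil>"
  have N: "N \<ge> 1" "R \<le> N" "real N \<le> 2 * R"
    using False by (auto simp: N_def) linarith+
  have "real N powr (1 - \<alpha>) \<le> (2 * R) powr (1 - \<alpha>)"
    using N \<alpha> by (intro powr_mono2) auto
  also have "\<dots> = 2 powr (1 - \<alpha>) * R powr (1 - \<alpha>)" using R by (simp add: powr_mult)
  also have "\<dots> \<le> 2 powr 1 * R powr (1 - \<alpha>)"
    using \<alpha> by (intro mult_right_mono powr_mono) auto
  finally have p1: "real N powr (1 - \<alpha>) \<le> 2 * R powr (1 - \<alpha>)" by simp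
  have p2: "real N powr (- b) \<le> R powr (- b)" using N R b by (intro powr_mono2') auto
  have "energy S c \<le> 2 * (1 + 4 * pi\<^sup>2) * C1 * real N powr (1 - \<alpha>) * (\<Sum>k\<in>S. (norm (c k))\<^sup>2)
                     + D * real N powr (- b) * (\<Sum>k\<in>S. norm (c k))\<^sup>2"
    using D by (intro energy_le_scale_nat[OF ball decay b _ S N(1)]) auto
  also have "\<dots> \<le> 2 * (1 + 4 * pi\<^sup>2) * C1 * (2 * R powr (1 - \<alpha>)) * (\<Sum>k\<in>S. (norm (c k))\<^sup>2)
                     + D * R powr (- b) * (\<Sum>k\<in>S. norm (c k))\<^sup>2"
    using ball_condition_C1_ge_1[OF ball] D p1 p2
    by (intro add_mono mult_right_mono mult_left_mono) (auto intro: sum_nonneg)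
  finally show ?thesis by (simp add: algebra_simps)
qed

text \<open>
The scale \<open>R\<close> is chosen to make the two terms of the previous bound equal; each then becomes the
geometric mean with weights \<open>1 - t\<close> and \<open>t\<close>. Applied to coefficients of constant modulus this is
an estimate of restricted type between \<open>\<ell>\<^sup>2\<close> and \<open>\<ell>\<^sup>1\<close>.
\<close>

lemma energy_restricted:
  assumes ball: "ball_condition C1 \<alpha> \<mu>"
    and decay: "\<And>j. j \<noteq> 0 \<Longrightarrow> norm (LINT x|\<mu>. character j x) \<le> D * \<bar>of_int j\<bar> powr (- b)"
    and b: "b > 0" "b \<le> 1" and D: "D \<ge> 1" and \<alpha>: "0 \<le> \<alpha>" "\<alpha> \<le> 1"
    and S: "finite S" and t: "t = (1 - \<alpha>) / (1 - \<alpha> + b)"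
  shows "energy S c \<le> (5 + 16 * pi\<^sup>2) *
      ((C1 * (\<Sum>k\<in>S. (norm (c k))\<^sup>2)) powr (1 - t) * (D * (\<Sum>k\<in>S. norm (c k))\<^sup>2) powr t)"
proof -
  define X where "X = C1 * (\<Sum>k\<in>S. (norm (c k))\<^sup>2)"
  define Y where "Y = D * (\<Sum>k\<in>S. norm (c k))\<^sup>2"
  have C1: "C1 \<ge> 1" by (rule ball_condition_C1_ge_1[OF ball])
  show ?thesis
  proof (cases "\<forall>k\<in>S. c k = 0")
    case True
    then show ?thesis using energy_le_sum_norm_sq[of S c] by simp
  next
    case False
    then obtain k where k: "k \<in> S" "c k \<noteq> 0" by blast
    then have "0 < (\<Sum>k\<in>S. (norm (c k))\<^sup>2)" "0 < (\<Sum>k\<in>S. norm (c k))"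
      using S by (auto intro!: sum_pos2[of S k])
    then have X: "X > 0" and Y: "Y > 0" using C1 D by (auto simp: X_def Y_def)
    have e: "1 - \<alpha> + b > 0" using b \<alpha> by simp
    define R where "R = (Y / X) powr (1 / (1 - \<alpha> + b))"
    have R: "R > 0" using X Y by (simp add: R_def)
    have t': "1 - t = b / (1 - \<alpha> + b)" using e by (simp add: t field_simps)
    have "R powr (1 - \<alpha>) * X = (Y / X) powr t * X"
      by (simp add: R_def powr_powr t)
    also have "\<dots> = X powr (1 - t) * Y powr t"
      using X Y by (simp add: powr_divide powr_diff)
    finally have 1: "R powr (1 - \<alpha>) * X = X powr (1 - t) * Y powr t" .
    have "R powr (- b) * Y = (Y / X) powr (- (1 - t)) * Y"
      by (simp add: R_def powr_powr t')
    also have "\<dots> = X powr (1 - t) * Y powr t"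
      using X Y by (simp add: powr_divide powr_diff powr_minus field_simps)
    finally have 2: "R powr (- b) * Y = X powr (1 - t) * Y powr t" .
    have "energy S c \<le> 4 * (1 + 4 * pi\<^sup>2) * (R powr (1 - \<alpha>) * X) + R powr (- b) * Y"
      unfolding X_def Y_def using b D \<alpha> by (intro energy_le_scale[OF ball decay _ _ _ _ _ S R]) auto
    also have "\<dots> = (5 + 16 * pi\<^sup>2) * (X powr (1 - t) * Y powr t)"
      unfolding 1 2 by (simp add: algebra_simps)
    finally show ?thesis unfolding X_def Y_def .
  qed
qed

end

section \<open>From restricted type to strong type\<close>

text \<open>
Cauchy-Schwarz with the weights \<open>(1/2) ^ l\<close>, whose sum is at most \<open>2\<close>. It serves as a triangle inequality
for summands decaying faster than these weights.
\<close>

lemma norm_sum_sq_le_dyadic: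
  fixes z :: "nat \<Rightarrow> complex"
  shows "(norm (\<Sum>l<M. z l))\<^sup>2 \<le> 2 * (\<Sum>l<M. 2 ^ l * (norm (z l))\<^sup>2)"
proof -
  have geo: "(\<Sum>l<M. (1/2::real) ^ l) \<le> 2" by (simp add: sum_gp_strict)
  have eq: "norm (z l) = sqrt ((1/2) ^ l) * (sqrt (2 ^ l) * norm (z l))" for l
    by (simp add: real_sqrt_mult[symmetric] power_mult_distrib[symmetric] mult.assoc[symmetric])
  have "(norm (\<Sum>l<M. z l))\<^sup>2 \<le> (\<Sum>l<M. norm (z l))\<^sup>2"
    by (intro power_mono norm_sum) auto
  also have "\<dots> = (\<Sum>l<M. sqrt ((1/2) ^ l) * (sqrt (2 ^ l) * norm (z l)))\<^sup>2"
    using eq by (simp only:)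
  also have "\<dots> \<le> (\<Sum>l<M. (sqrt ((1/2) ^ l))\<^sup>2) * (\<Sum>l<M. (sqrt (2 ^ l) * norm (z l))\<^sup>2)"
    by (rule Cauchy_Schwarz_ineq_sum)
  also have "\<dots> = (\<Sum>l<M. (1/2) ^ l) * (\<Sum>l<M. 2 ^ l * (norm (z l))\<^sup>2)"
    by (simp add: power_mult_distrib)
  also have "\<dots> \<le> 2 * (\<Sum>l<M. 2 ^ l * (norm (z l))\<^sup>2)"
    using geo by (intro mult_right_mono sum_nonneg) auto
  finally show ?thesis .
qed

context unit_interval_measure
begin

lemma energy_le_sum_levels:
  assumes S: "finite S" and lvl: "lvl ` S \<subseteq> {..<M}"
  shows "energy S c \<le> 2 * (\<Sum>l<M. 2 ^ l * energy {k \<in> S. lvl k = l} c)"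
proof -
  have "trig_poly S c x = (\<Sum>l<M. trig_poly {k \<in> S. lvl k = l} c x)" for x
    unfolding trig_poly_def using sum.group[OF S _ lvl] by (simp add: eq_commute)
  then have "energy S c \<le> (LINT x|\<mu>. 2 * (\<Sum>l<M. 2 ^ l * (norm (trig_poly {k \<in> S. lvl k = l} c x))\<^sup>2))"
    unfolding energy_def
    by (intro integral_mono integrable_trig_poly_sq integrable_mult_right
        Bochner_Integration.integrable_sum) (simp add: norm_sum_sq_le_dyadic)
  also have "\<dots> = 2 * (\<Sum>l<M. 2 ^ l * energy {k \<in> S. lvl k = l} c)"
    unfolding energy_def
    by (simp add: integrable_trig_poly_sq Bochner_Integration.integral_sum)
  finally show ?thesis .
qed

text \<open>
On a set where the moduli of the coefficients agree up to the factor \<open>2 powr (1 / s)\<close>, both the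
\<open>\<ell>\<^sup>2\<close> and the \<open>\<ell>\<^sup>1\<close> norm are controlled by the \<open>\<ell>\<^sup>p\<close> norm and the level. The exponent \<open>p\<close> is the
one for which \<open>s = (p - 1) t\<close> equals \<open>(2 - p) (1 - t) / 4\<close>; with this \<open>s\<close> the loss from the \<open>\<ell>\<^sup>1\<close>
norm and the gain from the \<open>\<ell>\<^sup>2\<close> norm combine to exactly \<open>4 (1/4)^l\<close>.
\<close>

lemma energy_level:
  fixes l :: nat
  assumes t: "0 < t" "t < 1" and p: "p = 2 * (1 + t) / (1 + 3 * t)"
    and s: "s = t * (1 - t) / (1 + 3 * t)" and K: "K \<ge> 0" and P: "P > 0"
    and weak: "energy T c \<le> K * ((\<Sum>k\<in>T. (norm (c k))\<^sup>2) powr (1 - t) * ((\<Sum>k\<in>T. norm (c k))\<^sup>2) powr t)"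
    and size: "\<And>k. k \<in> T \<Longrightarrow> P * 2 powr (- (real l + 1) / s) \<le> norm (c k)"
      "\<And>k. k \<in> T \<Longrightarrow> norm (c k) \<le> P * 2 powr (- real l / s)"
    and norm_p: "(\<Sum>k\<in>T. norm (c k) powr p) \<le> P powr p"
  shows "energy T c \<le> K * (4 * (1/4) ^ l * P\<^sup>2)"
proof -
  have s0: "s > 0" using t by (simp add: s)
  have p12: "1 < p" "p < 2" using t by (auto simp: p field_simps)
  have e1: "(2 - p) / s * (1 - t) = 4" and e2: "(p - 1) / s * t = 1"
    using t by (simp_all add: p s divide_simps)
  define u where "u = P * 2 powr (- real l / s)"
  define v where "v = P * 2 powr (- (real l + 1) / s)"
  have uv: "u > 0" "v > 0" using P by (simp_all add: u_def v_def)
  have pos: "norm (c k) > 0" if "k \<in> T" for k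
    using uv(2) size(1)[OF that] unfolding v_def by (rule less_le_trans)
  have "(\<Sum>k\<in>T. (norm (c k))\<^sup>2) \<le> (\<Sum>k\<in>T. u powr (2 - p) * norm (c k) powr p)"
  proof (rule sum_mono)
    fix k assume k: "k \<in> T"
    have "(norm (c k))\<^sup>2 = norm (c k) powr (2 - p) * norm (c k) powr p"
      using pos[OF k] by (simp add: powr_add[symmetric])
    also have "\<dots> \<le> u powr (2 - p) * norm (c k) powr p"
      using size(2)[OF k] p12 by (intro mult_right_mono powr_mono2) (auto simp: u_def)
    finally show "(norm (c k))\<^sup>2 \<le> u powr (2 - p) * norm (c k) powr p" .
  qed
  also have "\<dots> \<le> u powr (2 - p) * P powr p"
    unfolding sum_distrib_left[symmetric] by (intro mult_left_mono norm_p) auto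
  also have "\<dots> = P\<^sup>2 * 2 powr (- real l * ((2 - p) / s))"
  proof -
    have "u powr (2 - p) = P powr (2 - p) * 2 powr (- real l * ((2 - p) / s))"
      using P by (simp add: u_def powr_mult powr_powr)
    then have "u powr (2 - p) * P powr p
        = (P powr (2 - p) * P powr p) * 2 powr (- real l * ((2 - p) / s))"
      by (simp only: mult_ac)
    also have "P powr (2 - p) * P powr p = P\<^sup>2"
      using P by (simp add: powr_add[symmetric])
    finally show ?thesis .
  qed
  finally have l2: "(\<Sum>k\<in>T. (norm (c k))\<^sup>2) \<le> P\<^sup>2 * 2 powr (- real l * ((2 - p) / s))" .
  have "(\<Sum>k\<in>T. norm (c k)) \<le> (\<Sum>k\<in>T. v powr (1 - p) * norm (c k) powr p)"
  proof (rule sum_mono)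
    fix k assume k: "k \<in> T"
    have "norm (c k) = norm (c k) powr (1 - p) * norm (c k) powr p"
      using pos[OF k] by (simp add: powr_add[symmetric])
    also have "\<dots> \<le> v powr (1 - p) * norm (c k) powr p"
      using size(1)[OF k] p12 uv by (intro mult_right_mono powr_mono2') (auto simp: v_def)
    finally show "norm (c k) \<le> v powr (1 - p) * norm (c k) powr p" .
  qed
  also have "\<dots> \<le> v powr (1 - p) * P powr p"
    unfolding sum_distrib_left[symmetric] by (intro mult_left_mono norm_p) auto
  also have "\<dots> = P * 2 powr ((real l + 1) * ((p - 1) / s))"
  proof -
    have "- (real l + 1) / s * (1 - p) = (real l + 1) * ((p - 1) / s)"
      by (simp add: algebra_simps diff_divide_distrib)
    then have "v powr (1 - p) = P powr (1 - p) * 2 powr ((real l + 1) * ((p - 1) / s))"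
      using P by (simp only: v_def powr_mult powr_powr)
    then have "v powr (1 - p) * P powr p
        = (P powr (1 - p) * P powr p) * 2 powr ((real l + 1) * ((p - 1) / s))"
      by (simp only: mult_ac)
    also have "P powr (1 - p) * P powr p = P"
      using P by (simp add: powr_add[symmetric])
    finally show ?thesis .
  qed
  finally have "(\<Sum>k\<in>T. norm (c k)) \<le> P * 2 powr ((real l + 1) * ((p - 1) / s))" .
  then have "(\<Sum>k\<in>T. norm (c k))\<^sup>2 \<le> (P * 2 powr ((real l + 1) * ((p - 1) / s)))\<^sup>2"
    by (intro power_mono sum_nonneg) auto
  also have "\<dots> = P\<^sup>2 * 2 powr (2 * (real l + 1) * ((p - 1) / s))"
  proof -
    have "(2 powr a)\<^sup>2 = 2 powr (2 * a)" for a :: real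
      by (simp add: power2_eq_square powr_add[symmetric])
    then show ?thesis by (simp only: power_mult_distrib mult.assoc)
  qed
  finally have l1: "(\<Sum>k\<in>T. norm (c k))\<^sup>2 \<le> P\<^sup>2 * 2 powr (2 * (real l + 1) * ((p - 1) / s))" .
  have "(\<Sum>k\<in>T. (norm (c k))\<^sup>2) powr (1 - t) * ((\<Sum>k\<in>T. norm (c k))\<^sup>2) powr t
      \<le> (P\<^sup>2 * 2 powr (- real l * ((2 - p) / s))) powr (1 - t)
        * (P\<^sup>2 * 2 powr (2 * (real l + 1) * ((p - 1) / s))) powr t"
    using l1 l2 t by (intro mult_mono powr_mono2) (auto intro: sum_nonneg)
  also have "\<dots> = (P\<^sup>2 powr (1 - t) * P\<^sup>2 powr t) *
      (2 powr (- real l * ((2 - p) / s * (1 - t))) * 2 powr (2 * (real l + 1) * ((p - 1) / s * t)))"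
    by (simp add: powr_mult powr_powr mult_ac)
  also have "P\<^sup>2 powr (1 - t) * P\<^sup>2 powr t = P\<^sup>2"
    using P by (simp add: powr_add[symmetric])
  also have "2 powr (- real l * ((2 - p) / s * (1 - t))) * 2 powr (2 * (real l + 1) * ((p - 1) / s * t))
      = (4::real) * (1/4) ^ l"
  proof -
    have "(2::real) powr (- real l * 4) * 2 powr (2 * (real l + 1) * 1) = 2 powr (2 + real l * (- 2))"
      unfolding powr_add[symmetric] by (rule arg_cong) (simp add: algebra_simps)
    also have "\<dots> = 4 * (2 powr (- 2)) powr real l"
      by (simp only: powr_add powr_powr mult.commute) simp
    also have "(2::real) powr (- 2) = 1/4"
      by (simp add: powr_minus)
    also have "(1/4::real) powr real l = (1/4) ^ l" by (simp add: powr_realpow)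
    finally show ?thesis unfolding e1 e2 .
  qed
  finally have "(\<Sum>k\<in>T. (norm (c k))\<^sup>2) powr (1 - t) * ((\<Sum>k\<in>T. norm (c k))\<^sup>2) powr t
      \<le> P\<^sup>2 * (4 * (1/4) ^ l)" .
  then have "K * ((\<Sum>k\<in>T. (norm (c k))\<^sup>2) powr (1 - t) * ((\<Sum>k\<in>T. norm (c k))\<^sup>2) powr t)
      \<le> K * (P\<^sup>2 * (4 * (1/4) ^ l))"
    using K by (rule mult_left_mono)
  with weak show ?thesis by (simp add: mult_ac)
qed

text \<open>
The coefficients are grouped into level sets whose ratio \<open>2 powr (1 / s)\<close> depends on \<open>t\<close> and grows
without bound as \<open>t\<close> tends to \<open>0\<close>. This is the point of the argument: with ratio \<open>2\<close> about \<open>1 / s\<close>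
levels could contribute equally and the constant would blow up, whereas here the level energies
decay geometrically with the fixed ratio \<open>1/4\<close>, so the constant is \<open>16\<close> for every \<open>t\<close>.
\<close>

lemma energy_strong_type:
  assumes t: "0 < t" "t < 1" and p: "p = 2 * (1 + t) / (1 + 3 * t)"
    and K: "K \<ge> 0" and P: "P \<ge> 0" and S: "finite S"
    and weak: "\<And>T. T \<subseteq> S \<Longrightarrow> energy T c
      \<le> K * ((\<Sum>k\<in>T. (norm (c k))\<^sup>2) powr (1 - t) * ((\<Sum>k\<in>T. norm (c k))\<^sup>2) powr t)"
    and norm_p: "(\<Sum>k\<in>S. norm (c k) powr p) \<le> P powr p"
  shows "energy S c \<le> 16 * K * P\<^sup>2"
proof -
  have p0: "p > 0" using t by (simp add: p)
  define S' where "S' = {k \<in> S. c k \<noteq> 0}"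
  have S': "finite S'" "S' \<subseteq> S" using S by (auto simp: S'_def)
  have E: "energy S c = energy S' c"
    unfolding energy_def trig_poly_def S'_def using S
    by (intro Bochner_Integration.integral_cong refl arg_cong[of _ _ "\<lambda>z. (norm z)\<^sup>2"]
        sum.mono_neutral_right) auto
  have le_P: "norm (c k) \<le> P" if "k \<in> S" for k
  proof -
    have "norm (c k) powr p \<le> (\<Sum>k\<in>S. norm (c k) powr p)"
      using S that by (intro member_le_sum) auto
    then have "norm (c k) powr p \<le> P powr p" using norm_p by simp
    then show ?thesis using p0 P powr_less_mono2[of p P "norm (c k)"] by fastforce
  qed
  show ?thesis
  proof (cases "P = 0")
    case True
    then have "S' = {}" using le_P by (auto simp: S'_def)
    then show ?thesis using E True by (simp add: energy_def trig_poly_def)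
  next
    case False
    with P have P: "P > 0" by simp
    define s where "s = t * (1 - t) / (1 + 3 * t)"
    have s0: "s > 0" using t by (simp add: s_def)
    (* the level as a real number: norm (c k) = P * 2 powr (- y k / s) *)
    define y where "y = (\<lambda>k. - s * log 2 (norm (c k) / P))"
    define lvl where "lvl = (\<lambda>k. nat \<lfloor>y k\<rfloor>)"
    have y0: "y k \<ge> 0" if "k \<in> S'" for k
    proof -
      have "norm (c k) / P \<le> 1" "norm (c k) / P > 0"
        using le_P that P by (auto simp: S'_def)
      then have "log 2 (norm (c k) / P) \<le> 0" by simp
      then show ?thesis using s0 by (simp add: y_def mult_nonneg_nonpos)
    qed
    have lvl: "real (lvl k) \<le> y k" "y k < real (lvl k) + 1" if "k \<in> S'" for k
    proof -
      have "real (lvl k) = of_int \<lfloor>y k\<rfloor>" using y0[OF that] by (simp add: lvl_def)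
      then show "real (lvl k) \<le> y k" "y k < real (lvl k) + 1" by linarith+
    qed
    have c_eq: "norm (c k) = P * 2 powr (- y k / s)" if "k \<in> S'" for k
      using that s0 P by (simp add: y_def S'_def)
    obtain M where M: "lvl ` S' \<subseteq> {..<M}"
      using finite_nat_set_iff_bounded[of "lvl ` S'"] S' by auto
    have level: "energy {k \<in> S'. lvl k = l} c \<le> K * (4 * (1/4) ^ l * P\<^sup>2)" for l
    proof (rule energy_level[OF t p s_def K P])
      show "energy {k \<in> S'. lvl k = l} c \<le> K * ((\<Sum>k\<in>{k \<in> S'. lvl k = l}. (norm (c k))\<^sup>2) powr (1 - t)
          * ((\<Sum>k\<in>{k \<in> S'. lvl k = l}. norm (c k))\<^sup>2) powr t)"
        using S' by (intro weak) auto
      have "(\<Sum>k\<in>{k \<in> S'. lvl k = l}. norm (c k) powr p) \<le> (\<Sum>k\<in>S. norm (c k) powr p)"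
        using S S' by (intro sum_mono2) auto
      then show "(\<Sum>k\<in>{k \<in> S'. lvl k = l}. norm (c k) powr p) \<le> P powr p"
        using norm_p by simp
      fix k assume "k \<in> {k \<in> S'. lvl k = l}"
      then have k: "k \<in> S'" "lvl k = l" by auto
      show "P * 2 powr (- (real l + 1) / s) \<le> norm (c k)"
        unfolding c_eq[OF k(1)] using lvl[OF k(1)] P s0 k(2)
        by (intro mult_left_mono powr_mono divide_right_mono) auto
      show "norm (c k) \<le> P * 2 powr (- real l / s)"
        unfolding c_eq[OF k(1)] using lvl[OF k(1)] P s0 k(2)
        by (intro mult_left_mono powr_mono divide_right_mono) auto
    qed
    have "energy S' c \<le> 2 * (\<Sum>l<M. 2 ^ l * energy {k \<in> S'. lvl k = l} c)"
      by (rule energy_le_sum_levels[OF S'(1) M])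
    also have "\<dots> \<le> 2 * (\<Sum>l<M. 2 ^ l * (K * (4 * (1/4) ^ l * P\<^sup>2)))"
      by (intro mult_left_mono sum_mono level) auto
    also have "\<dots> = 8 * K * P\<^sup>2 * (\<Sum>l<M. (1/2) ^ l)"
    proof -
      have "2 ^ l * (K * (4 * (1/4) ^ l * P\<^sup>2)) = 4 * K * P\<^sup>2 * (1/2) ^ l" for l
      proof -
        have "(2::real) ^ l * (1/4) ^ l = (1/2) ^ l" by (simp add: power_mult_distrib[symmetric])
        moreover have "2 ^ l * (K * (4 * (1/4) ^ l * P\<^sup>2)) = 4 * K * P\<^sup>2 * (2 ^ l * (1/4) ^ l)"
          by (simp only: mult_ac)
        ultimately show ?thesis by (simp only:)
      qed
      then show ?thesis by (simp only: sum_distrib_left[symmetric])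
    qed
    also have "\<dots> \<le> 8 * K * P\<^sup>2 * 2"
      using K by (intro mult_left_mono) (auto simp: sum_gp_strict)
    finally show ?thesis using E by simp
  qed
qed

section \<open>The estimate for trigonometric polynomials\<close>

lemma fourier_measure_eq: "fourier_measure \<mu> k = (LINT x|\<mu>. character (- k) x)"
proof -
  have "fourier_measure \<mu> k = (LINT x:{0..1}|\<mu>. character (- k) x)"
    by (simp only: fourier_measure_def character_conv_exp)
  also have "\<dots> = (LINT x|\<mu>. character (- k) x)"
    unfolding set_lebesgue_integral_def using AE_unit_interval
    by (intro integral_cong_AE) (auto simp: measurable_cong_sets[OF sets_eq_borel refl])
  finally show ?thesis .
qed

end

text \<open>
Since \<open>d * ln (1 / d)\<close> is bounded, a power of \<open>d\<close> with exponent of order \<open>d\<close> is harmless. This is how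
the divergent factor \<open>(1 - \<alpha>) powr (- B)\<close> of the decay condition becomes \<open>2 powr (6 * B)\<close>.
\<close>

lemma powr_neg_self_bound:
  assumes "0 < (d::real)" "t \<le> 3 * d" "0 \<le> t"
  shows "d powr (- t) \<le> 2 powr 12"
proof -
  have "ln (1 / d) \<le> 1 / d - 1" using assms by (intro ln_le_minus_one) simp
  then have "- ln d \<le> 1 / d" using assms by (simp add: ln_div)
  then have "t * (- ln d) \<le> t * (1 / d)" using assms by (intro mult_left_mono) auto
  also have "\<dots> \<le> 3" using assms by (simp add: field_simps)
  finally have "d powr (- t) \<le> exp 3" using assms by (simp add: powr_def)
  also have "exp (3::real) = exp 1 ^ 3" by (simp add: exp_of_nat_mult[symmetric])
  also have "\<dots> \<le> 3 ^ 3" by (intro power_mono exp_le) auto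
  also have "\<dots> \<le> (2::real) powr 12" by simp
  finally show ?thesis .
qed

context unit_interval_measure
begin

text \<open>
With \<open>d = 1 - \<alpha>\<close> and \<open>t = d / (d + \<beta> / 2)\<close> the exponents are \<open>p = 2 (1 + t) / (1 + 3 t)\<close> and
\<open>\<theta> = 2 t / (1 + t)\<close>, the former being the exponent of the strong type estimate. That estimate gives the
constant \<open>C1 powr (1 - t) * D powr t\<close> with \<open>D = C2 * d powr (- B)\<close>; as \<open>C1\<close> and \<open>C2\<close> are at least
\<open>1\<close>, the inequalities \<open>1 - t \<le> 2 (1 - \<theta>)\<close> and \<open>t \<le> 2 \<theta>\<close> turn it into the required square. For
\<open>\<alpha> = 1\<close> one has \<open>p = 2\<close>, and the window estimate alone, whose power of \<open>N\<close> is then trivial, suffices.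
\<close>

lemma energy_le_lp:
  assumes \<alpha>: "2/3 < \<alpha>" "\<alpha> \<le> 1" and \<beta>: "2/3 < \<beta>" "\<beta> \<le> 1" and C2: "1 \<le> C2" and B: "0 \<le> B"
    and ball: "ball_condition C1 \<alpha> \<mu>" and decay: "decay_condition C2 B \<alpha> \<beta> \<mu>"
    and p: "p = 2 * (\<beta> + 4 * (1 - \<alpha>)) / (\<beta> + 8 * (1 - \<alpha>))" and \<theta>: "\<theta> = 2 / p - 1"
    and S: "finite S" and P: "P \<ge> 0" and norm_p: "(\<Sum>k\<in>S. norm (c k) powr p) \<le> P powr p"
  shows "energy S c \<le> 16 * (5 + 16 * pi\<^sup>2) * (2 powr (6 * B) * C2 powr \<theta> * C1 powr (1 - \<theta>))\<^sup>2 * P\<^sup>2"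
proof -
  have C1: "C1 \<ge> 1" by (rule ball_condition_C1_ge_1[OF ball])
  define Q where "Q = 2 powr (6 * B) * C2 powr \<theta> * C1 powr (1 - \<theta>)"
  have Q2: "Q\<^sup>2 = 2 powr (12 * B) * C2 powr (2 * \<theta>) * C1 powr (2 * (1 - \<theta>))"
  proof -
    have "(x powr a)\<^sup>2 = x powr (2 * a)" for x a :: real
      by (simp add: power2_eq_square powr_add[symmetric])
    then show ?thesis by (simp add: Q_def power_mult_distrib)
  qed
  show ?thesis
  proof (cases "\<alpha> = 1")
    case True
    then have p2: "p = 2" "\<theta> = 0" using p \<theta> \<beta> by auto
    define M where "M = (\<Sum>k\<in>S. \<bar>k\<bar>)"
    have kM: "\<bar>k\<bar> \<le> M" if "k \<in> S" for k
      unfolding M_def using S that by (intro member_le_sum) auto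
    have M0: "M \<ge> 0" unfolding M_def by (intro sum_nonneg) auto
    have "S \<subseteq> {- M..<- M + int (nat (2 * M + 1))}" using kM M0 by (force simp: abs_le_iff)
    then have "energy S c \<le> 2 * (1 + 4 * pi\<^sup>2) * C1 * real (nat (2 * M + 1)) powr (1 - \<alpha>) * (\<Sum>k\<in>S. (norm (c k))\<^sup>2)"
      by (rule energy_window[OF ball]) (use M0 in simp)
    also have "\<dots> = 2 * (1 + 4 * pi\<^sup>2) * C1 * (\<Sum>k\<in>S. (norm (c k))\<^sup>2)" using True M0 by simp
    also have "(\<Sum>k\<in>S. (norm (c k))\<^sup>2) = (\<Sum>k\<in>S. norm (c k) powr p)" by (simp add: p2)
    also have "2 * (1 + 4 * pi\<^sup>2) * C1 * (\<Sum>k\<in>S. norm (c k) powr p) \<le> 2 * (1 + 4 * pi\<^sup>2) * C1 * P powr p"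
      using C1 by (intro mult_left_mono norm_p) auto
    also have "P powr p = P\<^sup>2" using P by (simp add: p2)
    also have "2 * (1 + 4 * pi\<^sup>2) * C1 * P\<^sup>2 \<le> 16 * (5 + 16 * pi\<^sup>2) * Q\<^sup>2 * P\<^sup>2"
    proof (intro mult_right_mono mult_mono)
      have "1 * 1 * C1 powr 1 \<le> 2 powr (12 * B) * C2 powr (2 * \<theta>) * C1 powr (2 * (1 - \<theta>))"
        using C1 C2 B p2 by (intro mult_mono powr_mono) (auto simp: ge_one_powr_ge_zero)
      then show "C1 \<le> Q\<^sup>2" using C1 by (simp add: Q2)
    qed (use C1 in auto)
    finally show ?thesis unfolding Q_def .
  next
    case False
    define d where "d = 1 - \<alpha>"
    define t where "t = d / (d + \<beta> / 2)"
    have d: "0 < d" "d < 1/3" using \<alpha> False by (auto simp: d_def)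
    have t: "0 < t" "t < 1" using d \<beta> by (auto simp: t_def field_simps)
    have p_t: "p = 2 * (1 + t) / (1 + 3 * t)"
      using d \<beta> unfolding p t_def d_def[symmetric] by (simp add: divide_simps) (simp add: algebra_simps)
    have \<theta>_t: "\<theta> = 2 * t / (1 + t)"
      using t unfolding \<theta> p_t by (simp add: field_simps)
    define D where "D = C2 * d powr (- B)"
    have D: "D \<ge> 1"
    proof -
      have "d powr (- B) \<ge> 1" using d B by (simp add: powr_minus one_le_inverse_iff powr_le1)
      then have "1 * 1 \<le> C2 * d powr (- B)" using C2 by (intro mult_mono) auto
      then show ?thesis by (simp add: D_def)
    qed
    have decay': "norm (LINT x|\<mu>. character j x) \<le> D * \<bar>of_int j\<bar> powr (- (\<beta> / 2))" if "j \<noteq> 0" for j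
    proof -
      have "norm (fourier_measure \<mu> (- j)) \<le> C2 * (1 - \<alpha>) powr (- B) * \<bar>real_of_int (- j)\<bar> powr (- \<beta> / 2)"
        using decay that \<alpha> False unfolding decay_condition_def
        by (metis neg_equal_0_iff_equal order_le_imp_less_or_eq)
      then show ?thesis by (simp add: fourier_measure_eq D_def d_def)
    qed
    have "energy S c \<le> 16 * ((5 + 16 * pi\<^sup>2) * (C1 powr (1 - t) * D powr t)) * P\<^sup>2"
    proof (rule energy_strong_type[OF t p_t _ P S _ norm_p])
      fix T assume "T \<subseteq> S"
      then have T: "finite T" using S finite_subset by blast
      have "energy T c \<le> (5 + 16 * pi\<^sup>2) *
        ((C1 * (\<Sum>k\<in>T. (norm (c k))\<^sup>2)) powr (1 - t) * (D * (\<Sum>k\<in>T. norm (c k))\<^sup>2) powr t)"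
        using \<beta> \<alpha> by (intro energy_restricted[OF ball decay' _ _ D _ _ T]) (auto simp: t_def d_def)
      also have "\<dots> = (5 + 16 * pi\<^sup>2) * (C1 powr (1 - t) * D powr t) *
          ((\<Sum>k\<in>T. (norm (c k))\<^sup>2) powr (1 - t) * ((\<Sum>k\<in>T. norm (c k))\<^sup>2) powr t)"
        using C1 D by (simp add: powr_mult sum_nonneg mult_ac)
      finally show "energy T c \<le> (5 + 16 * pi\<^sup>2) * (C1 powr (1 - t) * D powr t) *
          ((\<Sum>k\<in>T. (norm (c k))\<^sup>2) powr (1 - t) * ((\<Sum>k\<in>T. norm (c k))\<^sup>2) powr t)" .
    qed simp
    also have "\<dots> \<le> 16 * ((5 + 16 * pi\<^sup>2) * Q\<^sup>2) * P\<^sup>2"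
    proof (intro mult_right_mono mult_left_mono)
      have "C1 powr (1 - t) \<le> C1 powr (2 * (1 - \<theta>))"
      proof (rule powr_mono)
        have "2 * (1 - \<theta>) = (1 - t) * (2 / (1 + t))" using t by (simp add: \<theta>_t field_simps)
        moreover have "(1 - t) * 1 \<le> (1 - t) * (2 / (1 + t))" using t by (intro mult_left_mono) auto
        ultimately show "1 - t \<le> 2 * (1 - \<theta>)" by simp
      qed (use C1 in auto)
      moreover have "C2 powr t \<le> C2 powr (2 * \<theta>)"
      proof (rule powr_mono)
        have "t * 1 \<le> t * (4 / (1 + t))" using t by (intro mult_left_mono) auto
        then show "t \<le> 2 * \<theta>" by (simp add: \<theta>_t mult.commute)
      qed (use C2 in auto)
      moreover have "(d powr (- B)) powr t \<le> 2 powr (12 * B)"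
      proof -
        have "t \<le> 3 * d"
        proof -
          have "3 * d * (1/3) \<le> 3 * d * (d + \<beta> / 2)" using d \<beta> by (intro mult_left_mono) auto
          then show ?thesis using d \<beta> by (simp add: t_def pos_divide_le_eq)
        qed
        then have "d powr (- t) \<le> 2 powr 12" using d t by (intro powr_neg_self_bound) auto
        then have "(d powr (- t)) powr B \<le> (2 powr 12) powr B" using B by (intro powr_mono2) auto
        then show ?thesis by (simp only: powr_powr) (simp add: mult.commute)
      qed
      ultimately have "C1 powr (1 - t) * (C2 powr t * (d powr (- B)) powr t)
          \<le> C1 powr (2 * (1 - \<theta>)) * (C2 powr (2 * \<theta>) * 2 powr (12 * B))"
        by (intro mult_mono) auto
      then show "C1 powr (1 - t) * D powr t \<le> Q\<^sup>2"
        using C2 by (simp add: Q2 D_def powr_mult mult_ac)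
    qed auto
    finally show ?thesis by (simp only: Q_def mult.assoc)
  qed
qed

end

section \<open>Fejer means\<close>

lemma fejer_weight_nonneg: "fejer_weight N m \<ge> 0"
  by (simp add: fejer_weight_def)

lemma fejer_weight_le_1: "fejer_weight N m \<le> 1"
  by (simp add: fejer_weight_def)

definition fejer_kernel :: "nat \<Rightarrow> real \<Rightarrow> real" where
  "fejer_kernel N t = (norm (trig_poly {0..<int N} (\<lambda>_. 1) t))\<^sup>2 / real N"

definition fejer_mean :: "nat \<Rightarrow> (real \<Rightarrow> complex) \<Rightarrow> real \<Rightarrow> complex" where
  "fejer_mean N f = trig_poly {- int N..int N} (\<lambda>m. fejer_weight N m * fourier_fun f m)"

text \<open>
The difference \<open>m\<close> occurs for \<open>N - |m|\<close> pairs. With a character for \<open>g\<close> this identifies the Fejer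
kernel, a square by definition, with the trigonometric sum having the Fejer weights.
\<close>

lemma sum_differences:
  fixes g :: "int \<Rightarrow> complex"
  assumes N: "N \<ge> 1"
  shows "(\<Sum>j\<in>{0..<int N}. \<Sum>k\<in>{0..<int N}. g (j - k))
       = of_nat N * (\<Sum>m\<in>{- int N..int N}. fejer_weight N m * g m)"
proof -
  let ?J = "{0..<int N}" and ?M = "{- int N..int N}"
  have "(\<Sum>j\<in>?J. \<Sum>k\<in>?J. g (j - k)) = (\<Sum>j\<in>?J. \<Sum>m\<in>{m \<in> ?M. j - m \<in> ?J}. g m)"
  proof (rule sum.cong[OF refl])
    fix j assume "j \<in> ?J"
    then show "(\<Sum>k\<in>?J. g (j - k)) = (\<Sum>m\<in>{m \<in> ?M. j - m \<in> ?J}. g m)"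
      by (intro sum.reindex_bij_witness[of _ "\<lambda>m. j - m" "\<lambda>k. j - k"]) auto
  qed
  also have "\<dots> = (\<Sum>j\<in>?J. \<Sum>m\<in>?M. if j - m \<in> ?J then g m else 0)"
    by (intro sum.cong refl sum.inter_filter) simp
  also have "\<dots> = (\<Sum>m\<in>?M. \<Sum>j\<in>?J. if j - m \<in> ?J then g m else 0)"
    by (rule sum.swap)
  also have "\<dots> = (\<Sum>m\<in>?M. of_nat N * (fejer_weight N m * g m))"
  proof (rule sum.cong[OF refl])
    fix m assume m: "m \<in> ?M"
    have "{j \<in> ?J. j - m \<in> ?J} = {max 0 m..<min (int N) (int N + m)}" by auto
    then have "card {j \<in> ?J. j - m \<in> ?J} = nat (int N - \<bar>m\<bar>)"
      by (auto simp: max_def min_def)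
    moreover have "real (nat (int N - \<bar>m\<bar>)) = real N * fejer_weight N m"
      using N m by (auto simp: fejer_weight_def max_def field_simps)
    ultimately have "complex_of_real (real (card {j \<in> ?J. j - m \<in> ?J})) = of_real (real N * fejer_weight N m)"
      by (simp only:)
    then have card: "of_nat (card {j \<in> ?J. j - m \<in> ?J}) = of_nat N * complex_of_real (fejer_weight N m)"
      by (simp only: of_real_mult of_real_of_nat_eq)
    have "(\<Sum>j\<in>?J. if j - m \<in> ?J then g m else 0) = (\<Sum>j\<in>{j \<in> ?J. j - m \<in> ?J}. g m)"
      by (rule sum.inter_filter[symmetric]) simp
    also have "\<dots> = of_nat (card {j \<in> ?J. j - m \<in> ?J}) * g m"
      by (rule sum_constant)
    finally show "(\<Sum>j\<in>?J. if j - m \<in> ?J then g m else 0) = of_nat N * (fejer_weight N m * g m)"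
      unfolding card by (simp only: mult.assoc)
  qed
  finally show ?thesis by (simp add: sum_distrib_left)
qed

lemma fejer_kernel_eq_sum:
  assumes "N \<ge> 1"
  shows "complex_of_real (fejer_kernel N t)
       = (\<Sum>m\<in>{- int N..int N}. fejer_weight N m * character m t)"
proof -
  have "complex_of_real (fejer_kernel N t) * of_nat N
      = complex_of_real ((norm (trig_poly {0..<int N} (\<lambda>_. 1) t))\<^sup>2)"
    using assms by (simp add: fejer_kernel_def)
  also have "\<dots> = of_nat N * (\<Sum>m\<in>{- int N..int N}. fejer_weight N m * character m t)"
    unfolding trig_poly_norm_sq sum_differences[OF assms, symmetric] by simp
  finally show ?thesis using assms by simp
qed

lemma fejer_kernel_nonneg: "fejer_kernel N t \<ge> 0"
  by (simp add: fejer_kernel_def)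

lemma continuous_on_fejer_kernel_diff: "continuous_on S (\<lambda>y. fejer_kernel N (x - y))"
proof -
  have "continuous_on UNIV (fejer_kernel N)"
    unfolding fejer_kernel_def[abs_def] divide_inverse by (intro continuous_intros)
  then show ?thesis
    by (rule continuous_on_compose2[where f = "\<lambda>y. x - y"]) (intro continuous_intros, simp)
qed

lemma fejer_kernel_has_integral:
  assumes "N \<ge> 1"
  shows "((\<lambda>y. fejer_kernel N (x - y)) has_integral 1) {0..1}"
proof -
  let ?c = "\<lambda>j. cnj (character j x)"
  have "trig_poly {0..<int N} (\<lambda>_. 1) (x - y) = cnj (trig_poly {0..<int N} ?c y)" for y
    by (simp add: trig_poly_def character_diff_arg)
  then have "fejer_kernel N (x - y) = (norm (trig_poly {0..<int N} ?c y))\<^sup>2 / real N" for y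
    by (simp add: fejer_kernel_def)
  moreover have "((\<lambda>y. (norm (trig_poly {0..<int N} ?c y))\<^sup>2 / real N) has_integral
      (\<Sum>j\<in>{0..<int N}. (norm (?c j))\<^sup>2) / real N) {0..1}"
    by (intro has_integral_divide parseval_trig_poly) simp
  ultimately show ?thesis using assms by simp
qed

text \<open>
The Dirichlet sum in the definition of the kernel is a geometric progression.
\<close>

lemma fejer_kernel_le:
  assumes "character 1 t \<noteq> 1"
  shows "fejer_kernel N t \<le> 4 / (norm (character 1 t - 1))\<^sup>2 / real N"
proof -
  define z where "z = character 1 t"
  have pow: "character (int j) t = z ^ j" for j
  proof -
    have "z ^ j = cis (real j * (2 * pi * of_int 1 * t))"
      unfolding z_def character_def by (rule Complex.DeMoivre)
    then show ?thesis by (simp add: character_def mult_ac)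
  qed
  have "trig_poly {0..<int N} (\<lambda>_. 1) t = (\<Sum>j<N. z ^ j)"
    unfolding trig_poly_def
    by (rule sum.reindex_bij_witness[of _ int nat]) (auto simp: pow[symmetric])
  also have "\<dots> = (z ^ N - 1) / (z - 1)"
    using assms by (subst geometric_sum) (auto simp: z_def)
  finally have "norm (trig_poly {0..<int N} (\<lambda>_. 1) t) = norm (z ^ N - 1) / norm (z - 1)"
    by (simp add: norm_divide)
  also have "norm (z ^ N - 1) \<le> norm (z ^ N) + norm (1 :: complex)" by (rule norm_triangle_ineq4)
  also have "\<dots> = 2" by (simp add: norm_power z_def)
  finally have "norm (trig_poly {0..<int N} (\<lambda>_. 1) t) \<le> 2 / norm (z - 1)"
    by (simp add: divide_right_mono)
  then have "(norm (trig_poly {0..<int N} (\<lambda>_. 1) t))\<^sup>2 \<le> (2 / norm (z - 1))\<^sup>2"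
    by (intro power_mono) auto
  then show ?thesis
    unfolding fejer_kernel_def z_def by (intro divide_right_mono) (auto simp: power_divide)
qed

text \<open>
The upper restriction on \<open>|t|\<close> keeps away from the period: \<open>x - y\<close> runs through \<open>{-1..1}\<close>, and the
kernel concentrates at \<open>\<plusminus>1\<close> as well as at \<open>0\<close>.
\<close>

lemma fejer_kernel_uniform_decay:
  assumes "0 < \<eta>"
  obtains b where "b > 0" "\<And>N t. \<eta> \<le> \<bar>t\<bar> \<Longrightarrow> \<bar>t\<bar> \<le> 1 - \<eta> \<Longrightarrow> fejer_kernel N t \<le> b / real N"
proof (cases "\<eta> \<le> 1 - \<eta>")
  case False
  then show ?thesis using that[of 1] by auto
next
  case True
  define T where "T = {- (1 - \<eta>)..- \<eta>} \<union> {\<eta>..1 - \<eta>}"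
  have "compact T" "T \<noteq> {}" using True by (auto simp: T_def)
  moreover have "continuous_on T (\<lambda>t. norm (character 1 t - 1))" by (intro continuous_intros)
  ultimately have "\<exists>t0\<in>T. \<forall>t\<in>T. norm (character 1 t0 - 1) \<le> norm (character 1 t - 1)"
    by (rule continuous_attains_inf)
  then obtain t0 where t0: "t0 \<in> T" "\<And>t. t \<in> T \<Longrightarrow> norm (character 1 t0 - 1) \<le> norm (character 1 t - 1)"
    by blast
  have ne: "character 1 t \<noteq> 1" if "t \<in> T" for t
  proof
    assume "character 1 t = 1"
    then have "cos (2 * pi * t) = 1" by (simp add: character_def complex_eq_iff)
    then obtain n where "2 * pi * t = real_of_int n * 2 * pi" using cos_one_2pi_int by auto
    then have "t = of_int n" by simp
    moreover have "0 < \<bar>t\<bar>" "\<bar>t\<bar> < 1" using that assms by (auto simp: T_def)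
    ultimately show False by simp
  qed
  define b where "b = 4 / (norm (character 1 t0 - 1))\<^sup>2"
  have "b > 0" using ne[OF t0(1)] by (simp add: b_def)
  moreover have "fejer_kernel N t \<le> b / real N" if "\<eta> \<le> \<bar>t\<bar>" "\<bar>t\<bar> \<le> 1 - \<eta>" for N t
  proof -
    have t: "t \<in> T" using that by (auto simp: T_def abs_if split: if_splits)
    have "fejer_kernel N t \<le> 4 / (norm (character 1 t - 1))\<^sup>2 / real N"
      by (rule fejer_kernel_le[OF ne[OF t]])
    also have "\<dots> \<le> b / real N"
      unfolding b_def using t0(2)[OF t] ne[OF t0(1)] ne[OF t] by (intro divide_right_mono divide_left_mono power_mono) auto
    finally show ?thesis .
  qed
  ultimately show ?thesis by (rule that)
qed

lemma set_integrable_mult_continuous: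
  fixes f g :: "real \<Rightarrow> complex"
  assumes "set_integrable lborel {0..1} f" "continuous_on UNIV g"
  shows "set_integrable lborel {0..1} (\<lambda>y. f y * g y)"
proof -
  obtain b where b: "\<And>y. y \<in> {0..1} \<Longrightarrow> norm (g y) \<le> b"
    using compact_continuous_image[of "{0..1}" g] assms(2) continuous_on_subset
    by (metis compact_Icc compact_imp_bounded bounded_iff imageI top_greatest)
  have "integrable lborel (\<lambda>y. b *\<^sub>R (indicator {0..1} y *\<^sub>R f y))"
    using assms(1) unfolding set_integrable_def by (rule integrable_scaleR_right)
  moreover have "(\<lambda>y. indicator {0..1} y *\<^sub>R (f y * g y)) \<in> borel_measurable lborel"
  proof -
    have "(\<lambda>y. indicator {0..1} y *\<^sub>R f y) \<in> borel_measurable lborel"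
      using assms(1) unfolding set_integrable_def by (rule borel_measurable_integrable)
    moreover have "g \<in> borel_measurable lborel"
      using borel_measurable_continuous_onI[OF assms(2)] by simp
    ultimately have "(\<lambda>y. (indicator {0..1} y *\<^sub>R f y) * g y) \<in> borel_measurable lborel"
      by (rule borel_measurable_times)
    then show ?thesis by simp
  qed
  moreover have "AE y in lborel.
      norm (indicator {0..1} y *\<^sub>R (f y * g y)) \<le> norm (b *\<^sub>R (indicator {0..1} y *\<^sub>R f y))"
  proof (rule AE_I2)
    fix y :: real
    show "norm (indicator {0..1} y *\<^sub>R (f y * g y)) \<le> norm (b *\<^sub>R (indicator {0..1} y *\<^sub>R f y))"
    proof (cases "y \<in> {0..1}")
      case True
      have "norm (f y) * norm (g y) \<le> norm (f y) * \<bar>b\<bar>"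
        using b[OF True] by (intro mult_left_mono) auto
      then show ?thesis using True by (simp add: norm_mult mult.commute)
    qed simp
  qed
  ultimately show ?thesis unfolding set_integrable_def
    by (rule Bochner_Integration.integrable_bound)
qed

lemma fejer_mean_eq_convolution:
  assumes f: "set_integrable lborel {0..1} f" and N: "N \<ge> 1"
  shows "fejer_mean N f x = (LINT y:{0..1}|lborel. f y * of_real (fejer_kernel N (x - y)))"
proof -
  have int: "set_integrable lborel {0..1} (\<lambda>y. fejer_weight N m * character m x * (f y * character (- m) y))" for m
    using set_integrable_mult_continuous[OF f continuous_on_character] by simp
  have "(LINT y:{0..1}|lborel. f y * of_real (fejer_kernel N (x - y)))
      = (LINT y:{0..1}|lborel. \<Sum>m\<in>{- int N..int N}. fejer_weight N m * character m x * (f y * character (- m) y))"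
    unfolding fejer_kernel_eq_sum[OF N] character_diff_arg sum_distrib_left
    by (intro set_lebesgue_integral_cong allI impI sum.cong) (auto simp: character_def cis_cnj mult_ac)
  also have "\<dots> = (\<Sum>m\<in>{- int N..int N}. LINT y:{0..1}|lborel. fejer_weight N m * character m x * (f y * character (- m) y))"
    using int unfolding set_lebesgue_integral_def set_integrable_def scaleR_sum_right
    by (intro Bochner_Integration.integral_sum)
  also have "\<dots> = (\<Sum>m\<in>{- int N..int N}. fejer_weight N m * character m x * fourier_fun f m)"
    by (simp only: set_integral_mult_right fourier_fun_def character_conv_exp)
  finally show ?thesis by (simp add: fejer_mean_def trig_poly_def mult_ac)
qed

text \<open>
Fejer's theorem at a single point. The kernel is uniformly small off a neighbourhood of \<open>x\<close>, so that
continuity is needed at \<open>x\<close> only and mere integrability elsewhere. At an endpoint the means see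
the values near both ends of the interval, which need not agree, so \<open>x\<close> has to be interior.
\<close>

lemma fejer_mean_tendsto:
  assumes f: "set_integrable lborel {0..1} f" and x: "x \<in> {0<..<1}"
    and cont: "continuous (at x within {0..1}) f"
  shows "(\<lambda>n. fejer_mean (Suc n) f x) \<longlonglongrightarrow> f x"
proof (rule tendstoI)
  fix e :: real assume "e > 0"
  define e' where "e' = e / 2"
  have e': "e' > 0" using \<open>e > 0\<close> by (simp add: e'_def)
  from cont e' obtain r where r: "r > 0"
    "\<And>y. y \<in> {0..1} \<Longrightarrow> dist y x < r \<Longrightarrow> dist (f y) (f x) < e'"
    unfolding continuous_within_eps_delta by blast
  (* the distance to the end points keeps x - y away from the period 1 *)
  define \<eta> where "\<eta> = Min {r, x, 1 - x}"
  have \<eta>: "\<eta> > 0" "\<eta> \<le> r" "\<eta> \<le> x" "\<eta> \<le> 1 - x" using r x by (auto simp: \<eta>_def)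
  obtain b where b: "b > 0" "\<And>N t. \<eta> \<le> \<bar>t\<bar> \<Longrightarrow> \<bar>t\<bar> \<le> 1 - \<eta> \<Longrightarrow> fejer_kernel N t \<le> b / real N"
    using fejer_kernel_uniform_decay[OF \<eta>(1)] by blast
  define h where "h = (\<lambda>y. f y - f x)"
  have const: "set_integrable lborel {0..1} (\<lambda>y::real. f x)"
    by (rule borel_integrable_atLeastAtMost'[OF continuous_on_const])
  have h: "set_integrable lborel {0..1} h" unfolding h_def using f const by (rule set_integral_diff)
  define I where "I = (LINT y:{0..1}|lborel. norm (h y))"
  have bound: "dist (fejer_mean N f x) (f x) \<le> e' + b / real N * I" if N: "N \<ge> 1" for N
  proof -
    let ?K = "\<lambda>y. fejer_kernel N (x - y)"
    have contK: "continuous_on UNIV ?K" by (rule continuous_on_fejer_kernel_diff)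
    then have contKc: "continuous_on UNIV (\<lambda>y. complex_of_real (?K y))" by (intro continuous_intros)
    have intK: "set_integrable lborel {0..1} ?K"
      using contK by (intro borel_integrable_atLeastAtMost') (auto intro: continuous_on_subset)
    have K1: "(LINT y:{0..1}|lborel. ?K y) = 1"
      using fejer_kernel_has_integral[OF N, of x] intK
      by (simp add: set_borel_integral_eq_integral(2) has_integral_iff)
    have K1c: "(LINT y:{0..1}|lborel. f x * complex_of_real (?K y)) = f x"
      by (simp add: set_integral_complex_of_real K1)
    have "fejer_mean N f x - f x
        = (LINT y:{0..1}|lborel. f y * complex_of_real (?K y)) - (LINT y:{0..1}|lborel. f x * complex_of_real (?K y))"
      unfolding K1c fejer_mean_eq_convolution[OF f N] ..
    also have "\<dots> = (LINT y:{0..1}|lborel. h y * complex_of_real (?K y))"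
      unfolding h_def left_diff_distrib
      by (intro set_integral_diff(2)[symmetric] set_integrable_mult_continuous f const contKc)
    finally have "dist (fejer_mean N f x) (f x) = norm (LINT y:{0..1}|lborel. h y * complex_of_real (?K y))"
      by (simp add: dist_norm)
    also have "\<dots> \<le> (LINT y:{0..1}|lborel. norm (h y * complex_of_real (?K y)))"
      by (intro set_integral_norm_bound set_integrable_mult_continuous h contKc)
    also have "\<dots> \<le> (LINT y:{0..1}|lborel. e' * ?K y + b / real N * norm (h y))"
    proof (rule set_integral_mono)
      show "set_integrable lborel {0..1} (\<lambda>y. norm (h y * complex_of_real (?K y)))"
        by (intro set_integrable_norm set_integrable_mult_continuous h contKc)
      show "set_integrable lborel {0..1} (\<lambda>y. e' * ?K y + b / real N * norm (h y))"
        using intK set_integrable_norm[OF h] by (intro set_integral_add(1) set_integrable_mult_right) auto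
      fix y :: real assume y: "y \<in> {0..1}"
      have K0: "?K y \<ge> 0" by (rule fejer_kernel_nonneg)
      show "norm (h y * complex_of_real (?K y)) \<le> e' * ?K y + b / real N * norm (h y)"
      proof (cases "\<bar>x - y\<bar> < \<eta>")
        case True
        then have "norm (h y) \<le> e'" using r(2)[OF y] \<eta>(2) by (simp add: h_def dist_norm abs_minus_commute)
        then have "norm (h y) * ?K y \<le> e' * ?K y" using K0 by (rule mult_right_mono)
        moreover have "0 \<le> b / real N * norm (h y)" using b(1) by simp
        ultimately show ?thesis using K0 by (simp add: norm_mult)
      next
        case False
        moreover have "\<bar>x - y\<bar> \<le> 1 - \<eta>" using y x \<eta> by auto
        ultimately have "?K y \<le> b / real N" by (intro b(2)) auto
        then have "?K y * norm (h y) \<le> b / real N * norm (h y)" by (rule mult_right_mono) simp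
        moreover have "0 \<le> e' * ?K y" using e' K0 by simp
        ultimately show ?thesis using K0 by (simp add: norm_mult mult.commute)
      qed
    qed
    also have "\<dots> = e' + b / real N * I"
      using intK set_integrable_norm[OF h] by (simp add: set_integral_add(2) K1 I_def)
    finally show ?thesis .
  qed
  have "(\<lambda>n. b * I * inverse (real (Suc n))) \<longlonglongrightarrow> b * I * 0"
    by (intro tendsto_intros LIMSEQ_inverse_real_of_nat)
  then have "\<forall>\<^sub>F n in sequentially. b * I * inverse (real (Suc n)) < e'"
    using e' by (intro order_tendstoD(2)) auto
  then show "\<forall>\<^sub>F n in sequentially. dist (fejer_mean (Suc n) f x) (f x) < e"
  proof eventually_elim
    case (elim n)
    have "b / real (Suc n) * I = b * I * inverse (real (Suc n))" by (simp add: field_simps)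
    then show ?case using bound[of "Suc n"] elim by (simp add: e'_def)
  qed
qed

section \<open>The restriction estimate\<close>

context unit_interval_measure
begin

lemma AE_open_unit_interval:
  assumes ball: "ball_condition C1 \<alpha> \<mu>" and \<alpha>: "\<alpha> > 0"
  shows "AE x in \<mu>. x \<in> {0<..<1}"
proof -
  have null: "measure \<mu> {a} = 0" if a: "a \<in> {0..1}" for a
  proof (rule antisym)
    have "\<forall>\<^sub>F \<epsilon> in at_right (0::real). 0 \<le> \<epsilon>"
      using eventually_at_right_less by (rule eventually_mono) simp
    then have "((\<lambda>\<epsilon>. \<epsilon> powr \<alpha>) \<longlongrightarrow> 0) (at_right 0)"
      by (rule tendsto_zero_powrI[OF tendsto_ident_at tendsto_const _ \<alpha>])
    then have "((\<lambda>\<epsilon>. C1 * \<epsilon> powr \<alpha>) \<longlongrightarrow> C1 * 0) (at_right 0)"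
      by (rule tendsto_mult_left)
    moreover have "\<forall>\<^sub>F \<epsilon> in at_right 0. measure \<mu> {a} \<le> C1 * \<epsilon> powr \<alpha>"
    proof -
      have "measure \<mu> {a} \<le> C1 * \<epsilon> powr \<alpha>" if "\<epsilon> \<in> {0<..<1}" for \<epsilon>
      proof -
        have "measure \<mu> {a} \<le> measure \<mu> {a..a + \<epsilon>}"
          using that by (intro finite_measure_mono) auto
        also have "\<dots> \<le> C1 * \<epsilon> powr \<alpha>"
          using ball a that unfolding ball_condition_def by auto
        finally show ?thesis .
      qed
      then show ?thesis by (intro eventually_at_rightI[of 0 1]) auto
    qed
    ultimately show "measure \<mu> {a} \<le> 0"
      by (intro tendsto_lowerbound[where F = "at_right 0"]) auto
  qed simp
  have "AE x in \<mu>. x \<notin> {0}" "AE x in \<mu>. x \<notin> {1}"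
    using null[of 0] null[of 1] prob_eq_0[of "{0}"] prob_eq_0[of "{1}"] by auto
  with AE_unit_interval show ?thesis
    by eventually_elim auto
qed

text \<open>
By the continuity of \<open>f\<close> almost everywhere and the absence of atoms at \<open>0\<close> and \<open>1\<close>, the Fejer means
converge to \<open>f\<close> almost everywhere for \<open>\<mu>\<close>, and Fatou's lemma passes a uniform bound for them on to \<open>f\<close>.
\<close>

lemma restriction_estimate_of_trig_poly_estimate:
  assumes ball: "ball_condition C1 \<alpha> \<mu>" and \<alpha>: "\<alpha> > 0"
    and f: "admissible \<mu> f"
    and bound: "\<And>N. energy {- int N..int N} (\<lambda>m. fejer_weight N m * fourier_fun f m) \<le> Q"
  shows "set_integrable \<mu> {0..1} (\<lambda>x. (norm (f x))\<^sup>2)"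
    and "(LINT x:{0..1}|\<mu>. (norm (f x))\<^sup>2) \<le> Q"
proof -
  have f_int: "set_integrable lborel {0..1} f" and f_cont: "AE x in \<mu>. continuous (at x within {0..1}) f"
    using f by (auto simp: admissible_def)
  define g where "g = (\<lambda>x. indicator {0..1} x *\<^sub>R (norm (f x))\<^sup>2)"
  have g_meas: "g \<in> borel_measurable \<mu>"
  proof -
    have "(\<lambda>x. indicator {0..1} x *\<^sub>R f x) \<in> borel_measurable borel"
      using f_int unfolding set_integrable_def by (auto dest: borel_measurable_integrable)
    then have "(\<lambda>x. (norm (indicator {0..1} x *\<^sub>R f x))\<^sup>2) \<in> borel_measurable borel"
      by measurable
    moreover have "(\<lambda>x. (norm (indicator {0..1} x *\<^sub>R f x))\<^sup>2) = g"
      by (auto simp: g_def indicator_def)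
    ultimately show ?thesis using measurable_cong_sets[OF sets_eq_borel refl] by auto
  qed
  have g0: "g x \<ge> 0" for x by (simp add: g_def)
  define u where "u = (\<lambda>n x. (norm (fejer_mean (Suc n) f x))\<^sup>2)"
  have "AE x in \<mu>. (\<lambda>n. u n x) \<longlonglongrightarrow> g x"
    using AE_open_unit_interval[OF ball \<alpha>] f_cont
  proof eventually_elim
    case (elim x)
    have "(\<lambda>n. u n x) \<longlonglongrightarrow> (norm (f x))\<^sup>2"
      unfolding u_def by (intro tendsto_intros fejer_mean_tendsto f_int elim)
    then show ?case using elim by (simp add: g_def)
  qed
  then have "AE x in \<mu>. ennreal (g x) = liminf (\<lambda>n. ennreal (u n x))"
  proof eventually_elim
    case (elim x)
    then have "(\<lambda>n. ennreal (u n x)) \<longlonglongrightarrow> ennreal (g x)" by (intro tendsto_ennrealI)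
    then show ?case by (intro lim_imp_Liminf[symmetric]) auto
  qed
  then have "(\<integral>\<^sup>+x. ennreal (g x) \<partial>\<mu>) = (\<integral>\<^sup>+x. liminf (\<lambda>n. ennreal (u n x)) \<partial>\<mu>)"
    by (rule nn_integral_cong_AE)
  also have "\<dots> \<le> liminf (\<lambda>n. \<integral>\<^sup>+x. ennreal (u n x) \<partial>\<mu>)"
    by (intro nn_integral_liminf) (simp add: u_def fejer_mean_def)
  also have "\<dots> \<le> liminf (\<lambda>n::nat. ennreal Q)"
  proof (intro Liminf_mono always_eventually allI)
    fix n
    have "(\<integral>\<^sup>+x. ennreal (u n x) \<partial>\<mu>) = ennreal (energy {- int (Suc n)..int (Suc n)} (\<lambda>m. fejer_weight (Suc n) m * fourier_fun f m))"
      unfolding u_def fejer_mean_def energy_def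
      by (intro nn_integral_eq_integral integrable_trig_poly_sq) auto
    also have "\<dots> \<le> ennreal Q" by (intro ennreal_leI bound)
    finally show "(\<integral>\<^sup>+x. ennreal (u n x) \<partial>\<mu>) \<le> ennreal Q" .
  qed
  also have "\<dots> = ennreal Q" by (simp add: Liminf_const)
  finally have le: "(\<integral>\<^sup>+x. ennreal (g x) \<partial>\<mu>) \<le> ennreal Q" .
  then have fin: "(\<integral>\<^sup>+x. ennreal (g x) \<partial>\<mu>) < \<infinity>" by (auto simp: le_less_trans)
  have int: "integrable \<mu> g"
    using g_meas g0 fin by (intro integrableI_nonneg) auto
  then show "set_integrable \<mu> {0..1} (\<lambda>x. (norm (f x))\<^sup>2)"
    by (simp add: set_integrable_def g_def)
  have Q0: "Q \<ge> 0" using bound[of 0] energy_nonneg order_trans by blast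
  have "ennreal (integral\<^sup>L \<mu> g) \<le> ennreal Q"
    using le nn_integral_eq_integral[OF int] g0 by simp
  then have "integral\<^sup>L \<mu> g \<le> Q" using Q0 by simp
  then show "(LINT x:{0..1}|\<mu>. (norm (f x))\<^sup>2) \<le> Q"
    by (simp add: set_lebesgue_integral_def g_def)
qed

end

lemma sum_le_lp_norm_powr:
  assumes p: "p > 0" and c: "in_lp p c" and S: "finite S"
    and le: "\<And>k. k \<in> S \<Longrightarrow> norm (a k) \<le> norm (c k)"
  shows "(\<Sum>k\<in>S. norm (a k) powr p) \<le> lp_norm p c powr p"
proof -
  have "(\<Sum>k\<in>S. norm (a k) powr p) \<le> (\<Sum>k\<in>S. norm (c k) powr p)"
    using p le by (intro sum_mono powr_mono2) auto
  also have "\<dots> \<le> (\<Sum>\<^sub>\<infinity>k. norm (c k) powr p)"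
    using c S unfolding in_lp_def by (intro finite_sum_le_infsum) auto
  also have "\<dots> = lp_norm p c powr p"
    using p by (simp add: lp_norm_def powr_powr infsum_nonneg)
  finally show ?thesis .
qed

theorem proposition4p1:
  "\<exists>A::real. \<forall>(\<alpha>::real) (\<beta>::real) (C1::real) (C2::real) (B::real) (E::real set) (\<mu>::real measure).
     2/3 < \<alpha> \<and> \<alpha> \<le> 1 \<and> 2/3 < \<beta> \<and> \<beta> \<le> 1 \<and> 1 \<le> C2 \<and> 0 \<le> B \<and>
     E \<subseteq> {0..1} \<and> prob_measure_on E \<mu> \<and>
     ball_condition C1 \<alpha> \<mu> \<and> decay_condition C2 B \<alpha> \<beta> \<mu> \<longrightarrow>
     (let p = 2 * (\<beta> + 4 * (1 - \<alpha>)) / (\<beta> + 8 * (1 - \<alpha>));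
          \<theta> = 2 / p - 1
      in \<forall>f::real \<Rightarrow> complex. admissible \<mu> f \<and> in_lp p (fourier_fun f) \<longrightarrow>
           set_integrable \<mu> {0..1} (\<lambda>x. (norm (f x))\<^sup>2) \<and>
           (LINT x:{0..1}|\<mu>. (norm (f x))\<^sup>2) powr (1/2)
             \<le> 2 powr (6 * B) * A * C2 powr \<theta> * C1 powr (1 - \<theta>) * lp_norm p (fourier_fun f))"
proof (intro exI[of _ "4 * sqrt (5 + 16 * pi\<^sup>2)"] allI impI, elim conjE, unfold Let_def, intro allI impI, elim conjE)
  fix \<alpha> \<beta> C1 C2 B :: real and E :: "real set" and \<mu> :: "real measure" and f :: "real \<Rightarrow> complex"
  assume \<alpha>: "2/3 < \<alpha>" "\<alpha> \<le> 1" and \<beta>: "2/3 < \<beta>" "\<beta> \<le> 1" and C2: "1 \<le> C2" and B: "0 \<le> B"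
    and E: "E \<subseteq> {0..1}" and \<mu>: "prob_measure_on E \<mu>"
    and ball: "ball_condition C1 \<alpha> \<mu>" and decay: "decay_condition C2 B \<alpha> \<beta> \<mu>"
    and f: "admissible \<mu> f"
  define p where "p = 2 * (\<beta> + 4 * (1 - \<alpha>)) / (\<beta> + 8 * (1 - \<alpha>))"
  define \<theta> where "\<theta> = 2 / p - 1"
  define P where "P = lp_norm p (fourier_fun f)"
  define Q where "Q = 2 powr (6 * B) * C2 powr \<theta> * C1 powr (1 - \<theta>)"
  assume "in_lp (2 * (\<beta> + 4 * (1 - \<alpha>)) / (\<beta> + 8 * (1 - \<alpha>))) (fourier_fun f)"
  then have lp: "in_lp p (fourier_fun f)" by (simp only: p_def)
  have p0: "p > 0" using \<alpha> \<beta> by (simp add: p_def)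
  have P0: "P \<ge> 0" by (simp add: P_def lp_norm_def)
  have Q0: "Q \<ge> 0" by (simp add: Q_def)
  interpret prob_space \<mu> using \<mu> by (simp add: prob_measure_on_def)
  interpret unit_interval_measure \<mu>
  proof
    show "sets \<mu> = sets borel" using \<mu> by (simp add: prob_measure_on_def)
    have "AE x in \<mu>. x \<in> E" using \<mu> by (simp add: prob_measure_on_def)
    then show "AE x in \<mu>. x \<in> {0..1}" by eventually_elim (use E in auto)
  qed
  have bound: "energy {- int N..int N} (\<lambda>m. fejer_weight N m * fourier_fun f m)
      \<le> 16 * (5 + 16 * pi\<^sup>2) * Q\<^sup>2 * P\<^sup>2" for N
    unfolding Q_def
  proof (rule energy_le_lp[OF \<alpha> \<beta> C2 B ball decay p_def \<theta>_def _ P0])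
    show "(\<Sum>m\<in>{- int N..int N}. norm (fejer_weight N m * fourier_fun f m) powr p) \<le> P powr p"
      unfolding P_def
      using fejer_weight_nonneg fejer_weight_le_1
      by (intro sum_le_lp_norm_powr p0 lp) (auto simp: norm_mult intro!: mult_left_le_one_le)
  qed simp
  have \<alpha>0: "\<alpha> > 0" using \<alpha> by simp
  note est = restriction_estimate_of_trig_poly_estimate[OF ball \<alpha>0 f bound]
  have "(LINT x:{0..1}|\<mu>. (norm (f x))\<^sup>2) powr (1/2) = sqrt (LINT x:{0..1}|\<mu>. (norm (f x))\<^sup>2)"
    by (rule powr_half_sqrt) (simp add: set_lebesgue_integral_def)
  also have "\<dots> \<le> sqrt (16 * (5 + 16 * pi\<^sup>2) * Q\<^sup>2 * P\<^sup>2)"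
    by (rule real_sqrt_le_mono[OF est(2)])
  also have "\<dots> = 4 * sqrt (5 + 16 * pi\<^sup>2) * Q * P"
  proof -
    have "sqrt 16 = (4::real)" by (rule real_sqrt_unique) auto
    then show ?thesis using P0 Q0 by (simp only: real_sqrt_mult real_sqrt_abs abs_of_nonneg)
  qed
  finally have "(LINT x:{0..1}|\<mu>. (norm (f x))\<^sup>2) powr (1/2)
      \<le> 2 powr (6 * B) * (4 * sqrt (5 + 16 * pi\<^sup>2)) * C2 powr \<theta> * C1 powr (1 - \<theta>) * P"
    by (simp only: Q_def mult_ac)
  with est(1) show "set_integrable \<mu> {0..1} (\<lambda>x. (norm (f x))\<^sup>2) \<and>
     (LINT x:{0..1}|\<mu>. (norm (f x))\<^sup>2) powr (1/2)
       \<le> 2 powr (6 * B) * (4 * sqrt (5 + 16 * pi\<^sup>2))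
         * C2 powr (2 / (2 * (\<beta> + 4 * (1 - \<alpha>)) / (\<beta> + 8 * (1 - \<alpha>))) - 1)
         * C1 powr (1 - (2 / (2 * (\<beta> + 4 * (1 - \<alpha>)) / (\<beta> + 8 * (1 - \<alpha>))) - 1))
         * lp_norm (2 * (\<beta> + 4 * (1 - \<alpha>)) / (\<beta> + 8 * (1 - \<alpha>))) (fourier_fun f)"
    unfolding P_def \<theta>_def p_def ..
qed

end
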